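(* Let $I=[a,b]\subseteq\mathbb{R}$ be a bounded interval, let $q>1$, and let $g:I\to\mathbb{R}$ be a right-continuous function with finite $q$-variation such that $g(a)=g(b)$. Let $\alpha\in(1-1/q,1]$ and define $$\|g\|_{\mathsf{W}_\alpha}=\sup\Big\{\int_I f\,dg:\ \|f\|_{C^\alpha}\le1\Big\},$$ where the integral $\int_I f\,dg$ is in the sense of Young. Then the supremum is attained by some $f:I\to\mathbb{R}$ with $[f]_{C^\alpha}=1$, and $$\|g\|_{\mathsf{W}_\alpha}=\min_{\pi\in\Gamma_\alpha(g)}\int_{I\times I}|t-s|^\alpha\,\pi(ds,dt)<\infty$$ (in particular $\Gamma_\alpha(g)$ is non-empty and the minimum is attained).
   Context: **Hölder norm.** $[f]_{C^\alpha}=\sup_{s\ne t\in I}|f(t)-f(s)|/|t-s|^\alpha$, $\|f\|_{C^\alpha}=|f(c)|+[f]_{C^\alpha}$ for a fixed $c\in I$ (the choice is irrelevant), and $C^\alpha(I)$ is the space of functions with $\|f\|_{C^\alpha}<\infty$ (for $\alpha=1$, Lipschitz functions). **$q$-variation.** $[g]_{q\text{-var}}=\sup\big(\sum_{i=1}^m|g(t_i)-g(t_{i-1})|^q\big)^{1/q}$, the supremum being over all $t_0<t_1<\dots<t_m$ in $I$. **Young integral.** For $f\in C^\alpha(I)$ and $g$ of finite $q$-variation with $\alpha+1/q>1$, $\int_I f\,dg$ is the limit of $\sum_{i=1}^m f(t_{i-1})(g(t_i)-g(t_{i-1}))$ along partitions $a=t_0<\dots<t_m=b$ with mesh tending to $0$;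 it exists by Young's theorem. **Couplings.** $\Gamma_\alpha(g)$ is the set of positive Borel measures $\pi$ on $I\times I$ (not necessarily finite) such that $\int_{I\times I}|t-s|^\alpha\,\pi(ds,dt)<\infty$ and $$\int_{I\times I}\big(f(t)-f(s)\big)\,\pi(ds,dt)=\int_I f\,dg\qquad\text{for every } f\in C^\alpha(I).$$ *)

theory Defs
  imports "HOL-Analysis.Analysis"
begin

text \<open>
  Functions on an interval are total functions \<^typ>\<open>real \<Rightarrow> real\<close>; every notion below depends only
  on their values on the interval.  Suprema that may be infinite are taken in
  \<^typ>\<open>ennreal\<close> or \<^typ>\<open>ereal\<close>.
\<close>

definition holder_seminorm :: "real \<Rightarrow> real set \<Rightarrow> (real \<Rightarrow> real) \<Rightarrow> ennreal" where
  "holder_seminorm \<alpha> I f =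
     (SUP (s, t) \<in> {(s, t). s \<in> I \<and> t \<in> I \<and> s \<noteq> t}. ennreal (\<bar>f t - f s\<bar> / \<bar>t - s\<bar> powr \<alpha>))"

definition holder_norm :: "real \<Rightarrow> real set \<Rightarrow> real \<Rightarrow> (real \<Rightarrow> real) \<Rightarrow> ennreal" where
  "holder_norm \<alpha> I c f = ennreal \<bar>f c\<bar> + holder_seminorm \<alpha> I f"

definition holder_space :: "real \<Rightarrow> real set \<Rightarrow> (real \<Rightarrow> real) set" where
  "holder_space \<alpha> I = {f. holder_seminorm \<alpha> I f < \<infinity>}"

text \<open>The base point \<open>c\<close> is irrelevant for membership, which is why \<^const>\<open>holder_space\<close> does not
  carry it as a parameter.\<close>

lemma holder_space_iff_norm: "f \<in> holder_space \<alpha> I \<longleftrightarrow> holder_norm \<alpha> I c f < \<infinity>"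
  by (simp add: holder_space_def holder_norm_def)

definition q_variation :: "real \<Rightarrow> real set \<Rightarrow> (real \<Rightarrow> real) \<Rightarrow> ennreal" where
  "q_variation q I g =
     (SUP (m, t) \<in> {(m :: nat, t :: nat \<Rightarrow> real). (\<forall>i\<le>m. t i \<in> I) \<and> (\<forall>i<m. t i < t (Suc i))}.
        ennreal ((\<Sum>i<m. \<bar>g (t (Suc i)) - g (t i)\<bar> powr q) powr (1 / q)))"

text \<open>A partition \<open>a = t 0 < \<dots> < t m = b\<close>; the values of \<open>t\<close> beyond \<open>m\<close> are irrelevant.\<close>

definition is_partition :: "real \<Rightarrow> real \<Rightarrow> nat \<Rightarrow> (nat \<Rightarrow> real) \<Rightarrow> bool" where
  "is_partition a b m t \<longleftrightarrow> t 0 = a \<and> t m = b \<and> (\<forall>i<m. t i < t (Suc i))"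

definition has_young_integral ::
    "(real \<Rightarrow> real) \<Rightarrow> (real \<Rightarrow> real) \<Rightarrow> real \<Rightarrow> real \<Rightarrow> real \<Rightarrow> bool" where
  "has_young_integral f g a b L \<longleftrightarrow>
     (\<forall>\<epsilon>>0. \<exists>\<delta>>0. \<forall>m t. is_partition a b m t \<longrightarrow> (\<forall>i<m. t (Suc i) - t i < \<delta>) \<longrightarrow>
        \<bar>(\<Sum>i<m. f (t i) * (g (t (Suc i)) - g (t i))) - L\<bar> < \<epsilon>)"

definition young_integral :: "real \<Rightarrow> real \<Rightarrow> (real \<Rightarrow> real) \<Rightarrow> (real \<Rightarrow> real) \<Rightarrow> real" where
  "young_integral a b f g = (THE L. has_young_integral f g a b L)"

lemma partition_mesh_exists:
  assumes "a < b" "\<delta> > 0"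
  shows "\<exists>m t. is_partition a b m t \<and> (\<forall>i<m. t (Suc i) - t i < \<delta>)"
proof -
  obtain n :: nat where n: "(b - a) / \<delta> < real n"
    using reals_Archimedean2 by blast
  have "(b - a) / \<delta> > 0" using assms by simp
  then have n0: "real n > 0" using n by linarith
  define t where "t = (\<lambda>i. a + real i * ((b - a) / real n))"
  have step: "t (Suc i) - t i = (b - a) / real n" for i
    by (simp add: t_def add_divide_distrib diff_divide_distrib ring_distribs)
  have pos: "(b - a) / real n > 0" using assms n0 by simp
  have small: "(b - a) / real n < \<delta>" using n n0 assms by (simp add: field_simps)
  have "t i < t (Suc i)" for i using step[of i] pos by linarith
  moreover have "t 0 = a" "t n = b" using n0 by (simp_all add: t_def)
  ultimately have "is_partition a b n t" by (simp add: is_partition_def)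
  then show ?thesis using step small by metis
qed

lemma has_young_integral_unique:
  assumes "a < b" "has_young_integral f g a b L" "has_young_integral f g a b L'"
  shows "L = L'"
proof (rule ccontr)
  assume "L \<noteq> L'"
  define e where "e = \<bar>L - L'\<bar> / 2"
  have e: "e > 0" using \<open>L \<noteq> L'\<close> by (simp add: e_def)
  let ?S = "\<lambda>m t. \<Sum>i<m. f (t i) * (g (t (Suc i)) - g (t i))"
  obtain d1 where d1: "d1 > 0" "\<And>m t. is_partition a b m t \<Longrightarrow>
      \<forall>i<m. t (Suc i) - t i < d1 \<Longrightarrow> \<bar>?S m t - L\<bar> < e"
    using assms(2) e unfolding has_young_integral_def by meson
  obtain d2 where d2: "d2 > 0" "\<And>m t. is_partition a b m t \<Longrightarrow>
      \<forall>i<m. t (Suc i) - t i < d2 \<Longrightarrow> \<bar>?S m t - L'\<bar> < e"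
    using assms(3) e unfolding has_young_integral_def by meson
  obtain m t where p: "is_partition a b m t" "\<forall>i<m. t (Suc i) - t i < min d1 d2"
    using partition_mesh_exists[OF assms(1), of "min d1 d2"] d1(1) d2(1) by auto
  have "\<bar>?S m t - L\<bar> < e" "\<bar>?S m t - L'\<bar> < e"
    using d1(2)[OF p(1)] d2(2)[OF p(1)] p(2) by auto
  moreover have "\<bar>L - L'\<bar> \<le> \<bar>?S m t - L\<bar> + \<bar>?S m t - L'\<bar>"
    by (rule order_trans[OF _ abs_triangle_ineq4]) simp
  ultimately have "\<bar>L - L'\<bar> < 2 * e" by linarith
  then show False by (simp add: e_def)
qed

lemma young_integral_eq:
  assumes "a < b" "has_young_integral f g a b L"
  shows "young_integral a b f g = L"
  unfolding young_integral_def
  using assms has_young_integral_unique by blast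

definition W_norm :: "real \<Rightarrow> real \<Rightarrow> real \<Rightarrow> real \<Rightarrow> (real \<Rightarrow> real) \<Rightarrow> ereal" where
  "W_norm \<alpha> a b c g =
     (SUP f \<in> {f. holder_norm \<alpha> {a..b} c f \<le> 1}. ereal (young_integral a b f g))"

definition transport_cost :: "real \<Rightarrow> (real \<times> real) measure \<Rightarrow> ennreal" where
  "transport_cost \<alpha> \<pi> = (\<integral>\<^sup>+ (s, t). ennreal (\<bar>t - s\<bar> powr \<alpha>) \<partial>\<pi>)"

text \<open>For \<open>f\<close> in the Hoelder space the integrand \<open>f t - f s\<close> is Borel measurable and bounded by a
  multiple of \<open>\<bar>t - s\<bar> powr \<alpha>\<close>, so it is integrable as soon as the cost is finite.\<close>

definition couplings :: "real \<Rightarrow> real \<Rightarrow> real \<Rightarrow> (real \<Rightarrow> real) \<Rightarrow> (real \<times> real) measure set" where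
  "couplings \<alpha> a b g =
     {\<pi>. sets \<pi> = sets (restrict_space borel ({a..b} \<times> {a..b})) \<and>
         transport_cost \<alpha> \<pi> < \<infinity> \<and>
         (\<forall>f \<in> holder_space \<alpha> {a..b}.
            (\<integral>(s, t). f t - f s \<partial>\<pi>) = young_integral a b f g)}"

end

theory Submission
  imports Defs "HOL-Complex_Analysis.Great_Picard" "HOL-Probability.Probability"
begin

text \<open>
  By the Young--Loeve estimate, Riemann sums on a grid approximate \<open>J f = \<integral> f dg\<close> uniformly over the
  unit ball of the Hoelder seminorm, so \<open>J\<close> is continuous under pointwise convergence on that ball
  and a maximiser exists by Arzela--Ascoli; \<open>g a = g b\<close> makes constants irrelevant.

  For \<open>\<alpha> < 1\<close>, finite-dimensional convexity on the grid represents the Riemann sums, up to a small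
  error, as averages of the difference quotients \<open>(f t - f s) / \<bar>t - s\<bar>\<^sup>\<alpha>\<close> times a constant tending to
  the dual norm.  A weak limit of the averaging measures represents \<open>J\<close> on Lipschitz \<open>f\<close>, since the
  quotient then vanishes continuously on the diagonal: whatever mass escapes to the diagonal is
  invisible.  Lipschitz functions are dense in the Hoelder ball for pointwise convergence, so the
  representation extends to all \<open>f\<close>.

  For \<open>\<alpha> = 1\<close>, \<open>J f = - \<integral> f' (g - g a)\<close> and the dual norm is the \<open>L\<^sup>1\<close> norm of \<open>g - g a\<close>.  This
  function is Riemann integrable, hence the limit of lower step functions on dyadic intervals, whose
  increments are the weights of the atoms of an optimal coupling.
\<close>

text \<open>Uniformity over the ball comes from a surplus: since \<open>\<alpha> + 1/q > 1\<close>,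
  the exponent \<open>\<alpha>\<close> can be lowered to a \<open>\<beta>\<close> with
  \<open>\<beta> + 1/q > 1\<close>, and the spare power \<open>\<alpha> - \<beta>\<close> of the
  mesh is a rate that sees \<open>f\<close> only through its Hoelder constant. A coupling may have
  infinite mass, so compactness is applied to probability measures, which stand for
  \<open>\<bar>t - s\<bar>\<^sup>\<alpha> \<pi>\<close> up to a factor; the coupling is recovered by
  dividing by this weight off the diagonal. Mass on the diagonal can only lower the cost, and
  testing against the maximiser gives the opposite inequality. At \<open>\<alpha> = 1\<close>
  difference quotients tend to slopes at the diagonal, so mass lost there is not invisible and this
  argument breaks. What is needed then is a series of multiples of interval indicators for
  \<open>g - g a\<close> whose \<open>L\<^sup>1\<close> norms add up without cancellation. Lower
  step functions of the positive and negative parts provide it: under refinement their difference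
  never changes sign and only grows in absolute value.\<close>

section \<open>A discrete Young-Loeve estimate\<close>

text \<open>The range is cut where half of the control is spent, and the single step from
  \<open>l\<close> to \<open>Suc l\<close> is taken out: it may carry a large jump of
  \<open>K\<close>, but both remaining pieces have at most half of the control. As the exponent
  exceeds one, the halved pieces contract and the recursion closes with a constant independent of
  \<open>m\<close>.\<close>

lemma young_loeve_sequence:
  fixes f g K :: "nat \<Rightarrow> real"
  assumes mono: "\<And>i j. i \<le> j \<Longrightarrow> j \<le> m \<Longrightarrow> K i \<le> K j"
    and f: "\<And>i j. i \<le> j \<Longrightarrow> j \<le> m \<Longrightarrow> \<bar>f j - f i\<bar> \<le> A * (K j - K i) powr \<beta>"
    and g: "\<And>i j. i \<le> j \<Longrightarrow> j \<le> m \<Longrightarrow> \<bar>g j - g i\<bar> \<le> (K j - K i) powr \<gamma>"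
    and A: "A \<ge> 0" and \<beta>: "\<beta> > 0" and \<gamma>: "\<gamma> > 0" and \<theta>: "\<beta> + \<gamma> > 1"
    and ij: "i \<le> j" "j \<le> m"
  shows "\<bar>(\<Sum>k\<in>{i..<j}. f k * (g (Suc k) - g k)) - f i * (g j - g i)\<bar>
      \<le> 2 * A / (1 - 2 powr (1 - (\<beta> + \<gamma>))) * (K j - K i) powr (\<beta> + \<gamma>)"
  using ij
proof (induction "j - i" arbitrary: i j rule: less_induct)
  case less
  \<comment> \<open>The solution of
    \<open>C = C * 2 powr (1 - (\<beta> + \<gamma>)) + 2 * A\<close>: two halved pieces plus two
    cross terms.\<close>
  define C where "C = 2 * A / (1 - 2 powr (1 - (\<beta> + \<gamma>)))"
  have lt1: "2 powr (1 - (\<beta> + \<gamma>)) < 1"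
    using \<theta> by (simp add: powr_less_one)
  then have C0: "C \<ge> 0" using A by (simp add: C_def)
  define w where "w = K j - K i"
  have w0: "w \<ge> 0" using mono[OF less.prems] by (simp add: w_def)
  show ?case
  proof (cases "j = i")
    case True
    then show ?thesis by simp
  next
    case False
    then have "i < j" using less.prems by simp
    define l where "l = (GREATEST k. i \<le> k \<and> k < j \<and> K k - K i \<le> w / 2)"
    have ex: "i \<le> i \<and> i < j \<and> K i - K i \<le> w / 2"
      using \<open>i < j\<close> w0 by simp
    have l: "i \<le> l \<and> l < j \<and> K l - K i \<le> w / 2"
      unfolding l_def
      by (rule GreatestI_nat[where P="\<lambda>k. i \<le> k \<and> k < j \<and> K k - K i \<le> w / 2" and b=j, OF ex]) auto
    have right: "K j - K (Suc l) \<le> w / 2"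
    proof (cases "Suc l = j")
      case True
      then show ?thesis using w0 by simp
    next
      case False
      have "\<not> (i \<le> Suc l \<and> Suc l < j \<and> K (Suc l) - K i \<le> w / 2)"
      proof
        assume *: "i \<le> Suc l \<and> Suc l < j \<and> K (Suc l) - K i \<le> w / 2"
        have "Suc l \<le> l"
          unfolding l_def
          by (rule Greatest_le_nat[where P="\<lambda>k. i \<le> k \<and> k < j \<and> K k - K i \<le> w / 2" and b=j])
             (use * l_def in auto)
        then show False by simp
      qed
      then have "K (Suc l) - K i > w / 2" using l False by auto
      then show ?thesis by (simp add: w_def)
    qed
    have IH1: "\<bar>(\<Sum>k\<in>{i..<l}. f k * (g (Suc k) - g k)) - f i * (g l - g i)\<bar>
        \<le> C * (K l - K i) powr (\<beta> + \<gamma>)"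
      unfolding C_def by (rule less.hyps) (use l less.prems in auto)
    have IH2: "\<bar>(\<Sum>k\<in>{Suc l..<j}. f k * (g (Suc k) - g k)) - f (Suc l) * (g j - g (Suc l))\<bar>
        \<le> C * (K j - K (Suc l)) powr (\<beta> + \<gamma>)"
      unfolding C_def by (rule less.hyps) (use l less.prems in auto)
    have half: "C * x powr (\<beta> + \<gamma>) \<le> C * (w / 2) powr (\<beta> + \<gamma>)" if "0 \<le> x" "x \<le> w / 2" for x
      using that C0 \<theta> by (intro mult_left_mono powr_mono2) auto
    have split: "(\<Sum>k\<in>{i..<j}. f k * (g (Suc k) - g k)) =
        (\<Sum>k\<in>{i..<l}. f k * (g (Suc k) - g k)) + f l * (g (Suc l) - g l)
        + (\<Sum>k\<in>{Suc l..<j}. f k * (g (Suc k) - g k))"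
    proof -
      have "{i..<j} = {i..<l} \<union> {l} \<union> {Suc l..<j}" using l by auto
      then have "(\<Sum>k\<in>{i..<j}. f k * (g (Suc k) - g k)) =
        (\<Sum>k\<in>{i..<l} \<union> {l} \<union> {Suc l..<j}. f k * (g (Suc k) - g k))" by simp
      also have "\<dots> = (\<Sum>k\<in>{i..<l}. f k * (g (Suc k) - g k)) + f l * (g (Suc l) - g l)
        + (\<Sum>k\<in>{Suc l..<j}. f k * (g (Suc k) - g k))"
        by (subst sum.union_disjoint; auto)+
      finally show ?thesis .
    qed
    have prod: "\<bar>(f x - f i) * (g z - g y)\<bar> \<le> A * w powr (\<beta> + \<gamma>)"
      if "i \<le> x" "i \<le> y" "x \<le> j" "y \<le> z" "z \<le> j" for x y z
    proof -
      have "\<bar>f x - f i\<bar> \<le> A * (K x - K i) powr \<beta>"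
        using f[of i x] that less.prems by auto
      also have "\<dots> \<le> A * w powr \<beta>"
        using A \<beta> mono[of i x] mono[of x j] that less.prems
        by (intro mult_left_mono powr_mono2) (auto simp: w_def)
      finally have 1: "\<bar>f x - f i\<bar> \<le> A * w powr \<beta>" .
      have "\<bar>g z - g y\<bar> \<le> (K z - K y) powr \<gamma>"
        using g[of y z] that less.prems by auto
      also have "\<dots> \<le> w powr \<gamma>"
        using \<gamma> mono[of i y] mono[of y z] mono[of z j] that less.prems
        by (intro powr_mono2) (auto simp: w_def)
      finally have 2: "\<bar>g z - g y\<bar> \<le> w powr \<gamma>" .
      have "\<bar>f x - f i\<bar> * \<bar>g z - g y\<bar> \<le> (A * w powr \<beta>) * w powr \<gamma>"
        using 1 2 A by (intro mult_mono) auto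
      then show ?thesis by (simp add: abs_mult powr_add mult.assoc)
    qed
    have "\<bar>(\<Sum>k\<in>{i..<j}. f k * (g (Suc k) - g k)) - f i * (g j - g i)\<bar>
      \<le> C * (w / 2) powr (\<beta> + \<gamma>) + C * (w / 2) powr (\<beta> + \<gamma>) + A * w powr (\<beta> + \<gamma>) + A * w powr (\<beta> + \<gamma>)"
    proof -
      have e: "(\<Sum>k\<in>{i..<j}. f k * (g (Suc k) - g k)) - f i * (g j - g i) =
        ((\<Sum>k\<in>{i..<l}. f k * (g (Suc k) - g k)) - f i * (g l - g i))
        + ((\<Sum>k\<in>{Suc l..<j}. f k * (g (Suc k) - g k)) - f (Suc l) * (g j - g (Suc l)))
        + (f l - f i) * (g (Suc l) - g l) + (f (Suc l) - f i) * (g j - g (Suc l))"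
        unfolding split by (simp add: algebra_simps)
      have 1: "\<bar>(\<Sum>k\<in>{i..<l}. f k * (g (Suc k) - g k)) - f i * (g l - g i)\<bar> \<le> C * (w / 2) powr (\<beta> + \<gamma>)"
        using IH1 half[of "K l - K i"] l mono[of i l] less.prems by auto
      have 2: "\<bar>(\<Sum>k\<in>{Suc l..<j}. f k * (g (Suc k) - g k)) - f (Suc l) * (g j - g (Suc l))\<bar>
          \<le> C * (w / 2) powr (\<beta> + \<gamma>)"
        using IH2 half[of "K j - K (Suc l)"] l right mono[of "Suc l" j] less.prems by auto
      have 3: "\<bar>(f l - f i) * (g (Suc l) - g l)\<bar> \<le> A * w powr (\<beta> + \<gamma>)"
        by (rule prod) (use l in auto)
      have 4: "\<bar>(f (Suc l) - f i) * (g j - g (Suc l))\<bar> \<le> A * w powr (\<beta> + \<gamma>)"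
        by (rule prod) (use l in auto)
      show ?thesis unfolding e using 1 2 3 4 by linarith
    qed
    also have "\<dots> = (C * 2 powr (1 - (\<beta> + \<gamma>)) + 2 * A) * w powr (\<beta> + \<gamma>)"
      using w0 by (simp add: powr_divide powr_diff algebra_simps)
    also have "C * 2 powr (1 - (\<beta> + \<gamma>)) + 2 * A = C"
      using lt1 \<theta> by (simp add: C_def divide_simps) (simp add: algebra_simps)
    finally show ?thesis by (simp add: w_def C_def)
  qed
qed

lemma has_young_integral_const:
  assumes "g a = g b"
  shows "has_young_integral (\<lambda>_. k) g a b 0"
proof -
  have "(\<Sum>i<m. k * (g (t (Suc i)) - g (t i))) = 0" if "is_partition a b m t" for m t
    using that assms sum_lessThan_telescope[of "\<lambda>i. g (t i)" m]
    by (simp add: is_partition_def flip: sum_distrib_left)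
  then show ?thesis
    unfolding has_young_integral_def using zero_less_one by (auto intro!: exI[of _ 1])
qed

subsection \<open>Young integration against a function of finite variation\<close>

text \<open>A real-valued, division-free form of a bound on the \<open>ennreal\<close> seminorm;
  \<open>0 \<le> A\<close> is built in so that estimates can be multiplied by \<open>A\<close> at
  once.\<close>

definition holder_bound :: "real \<Rightarrow> real \<Rightarrow> real set \<Rightarrow> (real \<Rightarrow> real) \<Rightarrow> bool" where
  "holder_bound A \<alpha> I f \<longleftrightarrow> 0 \<le> A \<and> (\<forall>s\<in>I. \<forall>t\<in>I. \<bar>f t - f s\<bar> \<le> A * \<bar>t - s\<bar> powr \<alpha>)"

lemma holder_boundD:
  "holder_bound A \<alpha> I f \<Longrightarrow> s \<in> I \<Longrightarrow> t \<in> I \<Longrightarrow> \<bar>f t - f s\<bar> \<le> A * \<bar>t - s\<bar> powr \<alpha>"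
  "holder_bound A \<alpha> I f \<Longrightarrow> 0 \<le> A"
  by (auto simp: holder_bound_def)

definition riemann_sum :: "(real \<Rightarrow> real) \<Rightarrow> (real \<Rightarrow> real) \<Rightarrow> nat \<Rightarrow> (nat \<Rightarrow> real) \<Rightarrow> real" where
  "riemann_sum f g m t = (\<Sum>i<m. f (t i) * (g (t (Suc i)) - g (t i)))"

abbreviation clamp_to :: "real \<Rightarrow> real \<Rightarrow> real \<Rightarrow> real" where
  "clamp_to s t x \<equiv> max s (min t x)"

text \<open>Clamping one partition to the intervals of another turns the Riemann sum over their common
  refinement into a double sum; by this identity it is symmetric in the two partitions.\<close>

lemma clamped_increment_commute:
  fixes f g :: "real \<Rightarrow> real"
  assumes "s \<le> t" "u \<le> v"
  shows "f (clamp_to s t u) * (g (clamp_to s t v) - g (clamp_to s t u)) =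
         f (clamp_to u v s) * (g (clamp_to u v t) - g (clamp_to u v s))"
proof -
  consider "v \<le> s" | "t \<le> u" | "u < t" "s < v" by linarith
  then show ?thesis
  proof cases
    case 1
    then have "clamp_to s t u = s" "clamp_to s t v = s" "clamp_to u v s = v" "clamp_to u v t = v"
      using assms by auto
    then show ?thesis by simp
  next
    case 2
    then have "clamp_to s t u = t" "clamp_to s t v = t" "clamp_to u v s = u" "clamp_to u v t = u"
      using assms by auto
    then show ?thesis by simp
  next
    case 3
    then have "clamp_to s t u = max s u" "clamp_to s t v = min t v"
      "clamp_to u v s = max s u" "clamp_to u v t = min t v"
      using assms by auto
    then show ?thesis by simp
  qed
qed

lemma partition_mono:
  assumes "is_partition a b m t" "i \<le> j" "j \<le> m"
  shows "t i \<le> t j"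
  using assms(2,3)
proof (induction j rule: dec_induct)
  case base
  then show ?case by simp
next
  case (step j)
  then have "t j < t (Suc j)" using assms(1) by (simp add: is_partition_def)
  then show ?case using step by simp
qed

lemma partition_in:
  assumes "is_partition a b m t" "i \<le> m"
  shows "t i \<in> {a..b}"
  using partition_mono[OF assms(1), of 0 i] partition_mono[OF assms(1), of i m] assms
  by (simp add: is_partition_def)

section \<open>A control for \<open>g\<close> and the Young integral with error bounds\<close>

locale young_setting =
  fixes a b q \<alpha> :: real and g :: "real \<Rightarrow> real"
  assumes ab: "a < b" and q: "1 < q" and qvar: "q_variation q {a..b} g < \<infinity>"
    and \<alpha>: "1 - 1 / q < \<alpha>" "\<alpha> \<le> 1"
begin

lemma \<alpha>_pos: "0 < \<alpha>"
proof -
  have "1 / q < 1" using q by simp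
  then show ?thesis using \<alpha> by linarith
qed

text \<open>The outer root of the variation is left off: in this form, adding a point to a chain
  adds its increment to the sum.\<close>

definition chain_sums :: "real \<Rightarrow> real set" where
  "chain_sums x = {\<Sum>i<m. \<bar>g (t (Suc i)) - g (t i)\<bar> powr q | (m :: nat) t.
     (\<forall>i\<le>m. t i \<in> {a..x}) \<and> (\<forall>i<m. t i < t (Suc i))}"

definition variation_to :: "real \<Rightarrow> real" where
  "variation_to x = Sup (chain_sums x)"

lemma chain_sums_nonempty: "a \<le> x \<Longrightarrow> chain_sums x \<noteq> {}"
  unfolding chain_sums_def by (auto intro!: exI[of _ 0] exI[of _ "\<lambda>_. a"])

lemma chain_sums_bdd: "x \<le> b \<Longrightarrow> bdd_above (chain_sums x)"
proof (rule bdd_aboveI)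
  fix S assume x: "x \<le> b" and "S \<in> chain_sums x"
  then obtain m :: nat and t where t: "\<forall>i\<le>m. t i \<in> {a..x}" "\<forall>i<m. t i < t (Suc i)"
    and S: "S = (\<Sum>i<m. \<bar>g (t (Suc i)) - g (t i)\<bar> powr q)"
    unfolding chain_sums_def by auto
  have S0: "S \<ge> 0" unfolding S by (intro sum_nonneg) auto
  have "ennreal (S powr (1 / q)) \<le> q_variation q {a..b} g"
    unfolding q_variation_def S
    by (rule SUP_upper2[of "(m, t)"]) (use t x in force)+
  then have "S powr (1 / q) \<le> enn2real (q_variation q {a..b} g)"
    using qvar by (metis enn2real_ennreal enn2real_mono infinity_ennreal_def powr_ge_zero)
  then have "(S powr (1 / q)) powr q \<le> enn2real (q_variation q {a..b} g) powr q"
    using q by (intro powr_mono2) auto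
  then show "S \<le> enn2real (q_variation q {a..b} g) powr q"
    using q S0 by (simp add: powr_powr)
qed

text \<open>Every chain in \<open>{a..s}\<close> is prolonged by \<open>t\<close>, after appending
  \<open>s\<close> if the chain ends earlier; that extra increment is nonnegative, so the last one
  is gained in full.\<close>

lemma variation_to_step:
  assumes "a \<le> s" "s \<le> t" "t \<le> b"
  shows "variation_to s + \<bar>g t - g s\<bar> powr q \<le> variation_to t"
proof (cases "s = t")
  case True
  then show ?thesis by simp
next
  case False
  then have st: "s < t" using assms by simp
  have "S + \<bar>g t - g s\<bar> powr q \<le> variation_to t" if S_in: "S \<in> chain_sums s" for S
  proof -
    obtain m :: nat and u where u: "\<forall>i\<le>m. u i \<in> {a..s}" "\<forall>i<m. u i < u (Suc i)"
      and S: "S = (\<Sum>i<m. \<bar>g (u (Suc i)) - g (u i)\<bar> powr q)"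
      using S_in unfolding chain_sums_def by auto
    have up: "S' \<le> variation_to t" if "S' \<in> chain_sums t" for S'
      unfolding variation_to_def by (rule cSup_upper[OF that chain_sums_bdd[OF assms(3)]])
    show ?thesis
    proof (cases "u m = s")
      case True
      define u' where "u' = (\<lambda>i. if i \<le> m then u i else t)"
      have "(\<Sum>i<Suc m. \<bar>g (u' (Suc i)) - g (u' i)\<bar> powr q) = S + \<bar>g t - g s\<bar> powr q"
        unfolding S u'_def using True by simp
      moreover have "(\<Sum>i<Suc m. \<bar>g (u' (Suc i)) - g (u' i)\<bar> powr q) \<in> chain_sums t"
        unfolding chain_sums_def mem_Collect_eq
        by (intro exI[of _ "Suc m"] exI[of _ u'])
           (use u st assms True in \<open>force simp: u'_def less_Suc_eq\<close>)
      ultimately show ?thesis using up by metis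
    next
      case False
      then have um: "u m < s" using u(1)[rule_format, of m] by auto
      define u' where "u' = (\<lambda>i. if i \<le> m then u i else if i = Suc m then s else t)"
      have "(\<Sum>i<Suc (Suc m). \<bar>g (u' (Suc i)) - g (u' i)\<bar> powr q)
          = S + \<bar>g s - g (u m)\<bar> powr q + \<bar>g t - g s\<bar> powr q"
        unfolding S u'_def by simp
      moreover have "(\<Sum>i<Suc (Suc m). \<bar>g (u' (Suc i)) - g (u' i)\<bar> powr q) \<in> chain_sums t"
        unfolding chain_sums_def mem_Collect_eq
        by (intro exI[of _ "Suc (Suc m)"] exI[of _ u'])
           (use u st assms um in \<open>force simp: u'_def less_Suc_eq\<close>)
      ultimately have "S + \<bar>g s - g (u m)\<bar> powr q + \<bar>g t - g s\<bar> powr q \<le> variation_to t"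
        using up by metis
      then show ?thesis using powr_ge_zero[of "\<bar>g s - g (u m)\<bar>" q] by linarith
    qed
  qed
  then have "variation_to s \<le> variation_to t - \<bar>g t - g s\<bar> powr q"
    unfolding variation_to_def[of s]
    by (intro cSup_least chain_sums_nonempty assms) (simp add: algebra_simps)
  then show ?thesis by simp
qed

text \<open>With \<open>x\<close> added, one nondecreasing function dominates both the length
  \<open>t - s\<close>, which measures \<open>f\<close>, and
  \<open>\<bar>g t - g s\<bar> powr q\<close>.\<close>

definition control :: "real \<Rightarrow> real" where
  "control x = x + variation_to x"

lemma control_step:
  assumes "a \<le> s" "s \<le> t" "t \<le> b"
  shows "control s + (t - s) \<le> control t"
  using variation_to_step[OF assms] powr_ge_zero[of "\<bar>g t - g s\<bar>" q]
  unfolding control_def by linarith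

lemma control_mono: "a \<le> s \<Longrightarrow> s \<le> t \<Longrightarrow> t \<le> b \<Longrightarrow> control s \<le> control t"
  using control_step[of s t] by simp

lemma increment_le_control:
  assumes "a \<le> s" "s \<le> t" "t \<le> b"
  shows "\<bar>g t - g s\<bar> \<le> (control t - control s) powr (1 / q)"
proof -
  have "\<bar>g t - g s\<bar> = (\<bar>g t - g s\<bar> powr q) powr (1 / q)"
    using q by (simp add: powr_powr)
  also have "\<dots> \<le> (control t - control s) powr (1 / q)"
    using variation_to_step[OF assms] assms q by (intro powr_mono2) (auto simp: control_def)
  finally show ?thesis .
qed

text \<open>The midpoint of \<open>1 - 1 / q\<close> and \<open>\<alpha>\<close>: its distance to
  the former keeps \<open>\<theta>\<close> above one, its distance to the latter leaves a positive
  power of the mesh.\<close>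

definition "\<beta> = (\<alpha> + 1 - 1 / q) / 2"
definition "\<theta> = \<beta> + 1 / q"

lemma \<beta>: "0 < \<beta>" "\<beta> < \<alpha>" and \<theta>: "1 < \<theta>"
proof -
  have "1 / q < 1" using q by simp
  then show "0 < \<beta>" "\<beta> < \<alpha>" "1 < \<theta>"
    using \<alpha> unfolding \<beta>_def \<theta>_def by (auto simp: field_simps)
qed

definition young_const :: real where
  "young_const = 2 / (1 - 2 powr (1 - \<theta>))"

lemma young_const_nonneg: "0 \<le> young_const"
  using \<theta> by (simp add: young_const_def powr_le_one_le less_imp_le powr_less_one)

abbreviation hol :: "real \<Rightarrow> (real \<Rightarrow> real) \<Rightarrow> bool" where
  "hol A f \<equiv> holder_bound A \<alpha> {a..b} f"

text \<open>Of the exponent \<open>\<alpha>\<close> of \<open>f\<close>, the part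
  \<open>\<beta>\<close> is paid by the control and \<open>\<alpha> - \<beta>\<close> by the bound
  \<open>\<delta>\<close> on the length. The points \<open>y\<close> are only weakly increasing
  because clamping a partition to \<open>[s,t]\<close> repeats the end points.\<close>

lemma young_loeve_local:
  assumes f: "hol A f" and st: "a \<le> s" "s \<le> t" "t \<le> b" "t - s \<le> \<delta>"
    and y: "y 0 = s" "y m = t" "\<And>i j. i \<le> j \<Longrightarrow> j \<le> m \<Longrightarrow> y i \<le> y j"
  shows "\<bar>riemann_sum f g m y - f s * (g t - g s)\<bar>
     \<le> A * young_const * \<delta> powr (\<alpha> - \<beta>) * (control t - control s) powr \<theta>"
proof -
  have in_st: "s \<le> y i \<and> y i \<le> t" if "i \<le> m" for i
    using y(3)[of 0 i] y(3)[of i m] that y(1,2) by auto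
  have A: "0 \<le> A" using f by (simp add: holder_boundD)
  have fb: "\<bar>f (y j) - f (y i)\<bar> \<le> (A * \<delta> powr (\<alpha> - \<beta>)) * (control (y j) - control (y i)) powr \<beta>"
    if ij: "i \<le> j" "j \<le> m" for i j
  proof -
    have i: "s \<le> y i" "y i \<le> y j" "y j \<le> t" using in_st y(3) ij by auto
    have c: "y j - y i \<le> control (y j) - control (y i)"
      using control_step[of "y i" "y j"] i st by auto
    have "\<bar>f (y j) - f (y i)\<bar> \<le> A * \<bar>y j - y i\<bar> powr \<alpha>"
      using f i st by (intro holder_boundD(1)[OF f]) auto
    also have "\<bar>y j - y i\<bar> powr \<alpha> = (y j - y i) powr (\<alpha> - \<beta>) * (y j - y i) powr \<beta>"
      using i by (simp flip: powr_add)
    also have "\<dots> \<le> \<delta> powr (\<alpha> - \<beta>) * (control (y j) - control (y i)) powr \<beta>"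
      using c i st \<beta> by (intro mult_mono powr_mono2) auto
    finally show ?thesis using A by (simp add: mult_left_mono mult.assoc)
  qed
  have "\<bar>(\<Sum>k\<in>{0..<m}. f (y k) * (g (y (Suc k)) - g (y k))) - f (y 0) * (g (y m) - g (y 0))\<bar>
      \<le> 2 * (A * \<delta> powr (\<alpha> - \<beta>)) / (1 - 2 powr (1 - (\<beta> + 1 / q)))
         * (control (y m) - control (y 0)) powr (\<beta> + 1 / q)"
  proof (rule young_loeve_sequence[where m=m])
    show "control (y i) \<le> control (y j)" if "i \<le> j" "j \<le> m" for i j
      using that in_st[of i] in_st[of j] y(3)[of i j] st by (intro control_mono) auto
    show "\<bar>g (y j) - g (y i)\<bar> \<le> (control (y j) - control (y i)) powr (1 / q)"
      if "i \<le> j" "j \<le> m" for i j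
      using that in_st[of i] in_st[of j] y(3)[of i j] st by (intro increment_le_control) auto
  qed (use fb A \<beta> \<theta> q in \<open>auto simp: \<theta>_def\<close>)
  then show ?thesis
    unfolding y riemann_sum_def young_const_def \<theta>_def
    by (simp add: lessThan_atLeast0 algebra_simps)
qed

definition young_error :: "real \<Rightarrow> real" where
  "young_error \<delta> = young_const * \<delta> powr (\<alpha> - \<beta>) * (control b - control a) powr \<theta>"

text \<open>Local errors are summed over the cells: one factor of the \<open>\<theta>\<close>-th
  power of each control increment is kept and telescopes, the remaining power is bounded by the
  total control.\<close>

lemma riemann_sum_refine:
  assumes f: "hol A f" and t: "is_partition a b m t" "\<forall>i<m. t (Suc i) - t i \<le> \<delta>"
    and u: "is_partition a b n u"
  shows "\<bar>riemann_sum f g m t - (\<Sum>j<m. riemann_sum f g n (\<lambda>i. clamp_to (t j) (t (Suc j)) (u i)))\<bar>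
    \<le> A * young_error \<delta>"
proof -
  have A: "0 \<le> A" using f by (simp add: holder_boundD)
  have tin: "a \<le> t j" "t j \<le> t (Suc j)" "t (Suc j) \<le> b" if "j < m" for j
    using that partition_in[OF t(1), of j] partition_in[OF t(1), of "Suc j"] t(1)
    by (auto simp: is_partition_def intro: less_imp_le)
  have step: "control (t (Suc j)) - control (t j) \<le> control b - control a"
    "0 \<le> control (t (Suc j)) - control (t j)" if "j < m" for j
    using that tin[of j] control_mono[of a "t j"] control_mono[of "t (Suc j)" b]
      control_mono[of "t j" "t (Suc j)"] by auto
  have loc: "\<bar>f (t j) * (g (t (Suc j)) - g (t j)) - riemann_sum f g n (\<lambda>i. clamp_to (t j) (t (Suc j)) (u i))\<bar>
    \<le> A * young_const * \<delta> powr (\<alpha> - \<beta>) *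
       ((control b - control a) powr (\<theta> - 1) * (control (t (Suc j)) - control (t j)))" if "j < m" for j
  proof -
    have "\<bar>riemann_sum f g n (\<lambda>i. clamp_to (t j) (t (Suc j)) (u i)) - f (t j) * (g (t (Suc j)) - g (t j))\<bar>
      \<le> A * young_const * \<delta> powr (\<alpha> - \<beta>) * (control (t (Suc j)) - control (t j)) powr \<theta>"
    proof (rule young_loeve_local[OF f])
      show "clamp_to (t j) (t (Suc j)) (u 0) = t j" "clamp_to (t j) (t (Suc j)) (u n) = t (Suc j)"
        using tin[OF that] u by (auto simp: is_partition_def)
      show "clamp_to (t j) (t (Suc j)) (u i) \<le> clamp_to (t j) (t (Suc j)) (u k)" if "i \<le> k" "k \<le> n" for i k
        using partition_mono[OF u that] by auto
    qed (use tin[OF that] t(2) that in auto)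
    moreover have "(control (t (Suc j)) - control (t j)) powr \<theta> =
        (control (t (Suc j)) - control (t j)) powr (\<theta> - 1) * (control (t (Suc j)) - control (t j))"
      using step(2)[OF that] by (cases "control (t (Suc j)) - control (t j) = 0") (auto simp: powr_diff)
    moreover have "\<dots> \<le> (control b - control a) powr (\<theta> - 1) * (control (t (Suc j)) - control (t j))"
      using step[OF that] \<theta> by (intro mult_right_mono powr_mono2) auto
    ultimately have "\<bar>riemann_sum f g n (\<lambda>i. clamp_to (t j) (t (Suc j)) (u i)) - f (t j) * (g (t (Suc j)) - g (t j))\<bar>
      \<le> A * young_const * \<delta> powr (\<alpha> - \<beta>) * ((control b - control a) powr (\<theta> - 1) * (control (t (Suc j)) - control (t j)))"
      using A young_const_nonneg by (smt (verit) mult_left_mono mult_nonneg_nonneg powr_ge_zero)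
    then show ?thesis by (simp add: abs_minus_commute)
  qed
  have "\<bar>riemann_sum f g m t - (\<Sum>j<m. riemann_sum f g n (\<lambda>i. clamp_to (t j) (t (Suc j)) (u i)))\<bar>
    = \<bar>\<Sum>j<m. (f (t j) * (g (t (Suc j)) - g (t j)) - riemann_sum f g n (\<lambda>i. clamp_to (t j) (t (Suc j)) (u i)))\<bar>"
    by (simp add: riemann_sum_def[of f g m t] sum_subtractf)
  also have "\<dots> \<le> (\<Sum>j<m. A * young_const * \<delta> powr (\<alpha> - \<beta>) *
       ((control b - control a) powr (\<theta> - 1) * (control (t (Suc j)) - control (t j))))"
    by (rule order_trans[OF sum_abs]) (intro sum_mono loc, simp)
  also have "\<dots> = A * young_const * \<delta> powr (\<alpha> - \<beta>) * ((control b - control a) powr (\<theta> - 1) * (control b - control a))"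
    using t(1) sum_lessThan_telescope[of "\<lambda>i. control (t i)" m]
    by (simp add: is_partition_def flip: sum_distrib_left)
  also have "(control b - control a) powr (\<theta> - 1) * (control b - control a) = (control b - control a) powr \<theta>"
    using control_mono[of a b] ab by (cases "control b - control a = 0") (auto simp: powr_diff)
  finally show ?thesis by (simp add: young_error_def mult.assoc)
qed

lemma riemann_sum_close:
  assumes f: "hol A f" and t: "is_partition a b m t" "\<forall>i<m. t (Suc i) - t i \<le> \<delta>"
    and u: "is_partition a b n u" "\<forall>i<n. u (Suc i) - u i \<le> \<delta>"
  shows "\<bar>riemann_sum f g m t - riemann_sum f g n u\<bar> \<le> 2 * A * young_error \<delta>"
proof -
  have "(\<Sum>j<m. riemann_sum f g n (\<lambda>i. clamp_to (t j) (t (Suc j)) (u i))) =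
      (\<Sum>j<m. \<Sum>i<n. f (clamp_to (u i) (u (Suc i)) (t j)) *
        (g (clamp_to (u i) (u (Suc i)) (t (Suc j))) - g (clamp_to (u i) (u (Suc i)) (t j))))"
    unfolding riemann_sum_def
    by (intro sum.cong refl clamped_increment_commute)
       (use t(1) u(1) in \<open>auto simp: is_partition_def intro: less_imp_le\<close>)
  also have "\<dots> = (\<Sum>i<n. riemann_sum f g m (\<lambda>j. clamp_to (u i) (u (Suc i)) (t j)))"
    unfolding riemann_sum_def by (rule sum.swap)
  finally show ?thesis
    using riemann_sum_refine[OF f t u(1)] riemann_sum_refine[OF f u t(1)] by linarith
qed

definition grid :: "nat \<Rightarrow> nat \<Rightarrow> real" where
  "grid n i = a + real i * ((b - a) / real n)"

lemma grid_step: "grid n (Suc i) - grid n i = (b - a) / real n"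
  by (simp add: grid_def algebra_simps add_divide_distrib diff_divide_distrib)

lemma grid_partition: "0 < n \<Longrightarrow> is_partition a b n (grid n)"
proof -
  assume n: "0 < n"
  have "grid n i < grid n (Suc i)" for i
  proof -
    have "0 < (b - a) / real n" using n ab by simp
    then show ?thesis using grid_step[of n i] by linarith
  qed
  then show ?thesis using n by (simp add: is_partition_def grid_def)
qed

lemma grid_in: "0 < n \<Longrightarrow> i \<le> n \<Longrightarrow> grid n i \<in> {a..b}"
  by (rule partition_in[OF grid_partition])

text \<open>The error of the \<open>n\<close>-cell sum, valid for all \<open>f\<close> of Hoelder
  constant one together; it returns as the excess in the approximate duality.\<close>

definition grid_error :: "nat \<Rightarrow> real" where
  "grid_error n = 2 * young_error ((b - a) / real n)"

lemma grid_error_tendsto: "grid_error \<longlonglongrightarrow> 0"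
proof -
  have "(\<lambda>n. (b - a) / real n) \<longlonglongrightarrow> 0"
    by (rule lim_const_over_n)
  moreover have "\<forall>\<^sub>F n in sequentially. 0 \<le> (b - a) / real n"
    using ab by (intro always_eventually) auto
  moreover have "0 < \<alpha> - \<beta>" using \<beta> by simp
  ultimately have "(\<lambda>n. ((b - a) / real n) powr (\<alpha> - \<beta>)) \<longlonglongrightarrow> 0 powr (\<alpha> - \<beta>)"
    using tendsto_powr'[OF _ tendsto_const, of "\<lambda>n. (b - a) / real n" 0 sequentially "\<alpha> - \<beta>"]
    by blast
  then have "(\<lambda>n. 2 * (young_const * ((b - a) / real n) powr (\<alpha> - \<beta>) * (control b - control a) powr \<theta>))
      \<longlonglongrightarrow> 2 * (young_const * 0 powr (\<alpha> - \<beta>) * (control b - control a) powr \<theta>)"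
    by (intro tendsto_mult tendsto_const)
  then show ?thesis unfolding grid_error_def young_error_def by simp
qed

abbreviation grid_sum :: "nat \<Rightarrow> (real \<Rightarrow> real) \<Rightarrow> real" where
  "grid_sum n f \<equiv> riemann_sum f g n (grid n)"

lemma young_limit_exists:
  assumes f: "hol A f"
  shows "\<exists>L. \<forall>m t \<delta>. is_partition a b m t \<longrightarrow> (\<forall>i<m. t (Suc i) - t i \<le> \<delta>) \<longrightarrow>
      \<bar>riemann_sum f g m t - L\<bar> \<le> 2 * A * young_error \<delta>"
proof -
  have A: "0 \<le> A" using f by (simp add: holder_boundD)
  have step_le: "\<forall>i<n. grid n (Suc i) - grid n i \<le> (b - a) / real N" if "N > 0" "N \<le> n" for n N
    using that ab by (auto simp: grid_step intro!: divide_left_mono)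
  have close: "\<bar>grid_sum m f - grid_sum n f\<bar> \<le> A * grid_error N" if "N > 0" "N \<le> n" "N \<le> m" for m n N
    using riemann_sum_close[OF f grid_partition step_le[of N m] grid_partition step_le[of N n]] that
    by (simp add: grid_error_def mult.assoc mult.left_commute)
  have "Cauchy (\<lambda>n. grid_sum n f)"
  proof (rule metric_CauchyI)
    fix e :: real assume e: "0 < e"
    have "(\<lambda>n. A * grid_error n) \<longlonglongrightarrow> A * 0"
      by (intro tendsto_intros grid_error_tendsto)
    then have "\<forall>\<^sub>F n in sequentially. A * grid_error n < e"
      using e by (auto dest: order_tendstoD)
    then obtain N where N: "\<And>n. N \<le> n \<Longrightarrow> A * grid_error n < e"
      by (auto simp: eventually_sequentially)
    show "\<exists>M. \<forall>m\<ge>M. \<forall>n\<ge>M. dist (grid_sum m f) (grid_sum n f) < e"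
    proof (intro exI[of _ "Suc N"] allI impI)
      fix m n assume "Suc N \<le> m" "Suc N \<le> n"
      then have "\<bar>grid_sum m f - grid_sum n f\<bar> \<le> A * grid_error (Suc N)" by (intro close) auto
      also have "\<dots> < e" by (rule N) simp
      finally show "dist (grid_sum m f) (grid_sum n f) < e" by (simp add: dist_real_def)
    qed
  qed
  then obtain L where L: "(\<lambda>n. grid_sum n f) \<longlonglongrightarrow> L"
    by (auto simp: Cauchy_convergent_iff convergent_def)
  have "\<bar>riemann_sum f g m t - L\<bar> \<le> 2 * A * young_error \<delta>"
    if t: "is_partition a b m t" "\<forall>i<m. t (Suc i) - t i \<le> \<delta>" for m t \<delta>
  proof (rule LIMSEQ_le_const2)
    show "(\<lambda>n. \<bar>riemann_sum f g m t - grid_sum n f\<bar>) \<longlonglongrightarrow> \<bar>riemann_sum f g m t - L\<bar>"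
      by (intro tendsto_intros L)
    \<comment> \<open>A partition of \<open>[a,b]\<close> has at least one cell, so
      \<open>\<delta>\<close> is positive and there are grids finer than
      \<open>\<delta>\<close>.\<close>
    have "0 < m" using t(1) ab by (cases m) (auto simp: is_partition_def)
    then have "\<delta> > 0" using t by (force simp: is_partition_def)
    obtain N :: nat where N: "(b - a) / \<delta> < real N"
      using reals_Archimedean2 by blast
    have N0: "N > 0" using N \<open>\<delta> > 0\<close> ab by (metis diff_gt_0_iff_gt divide_pos_pos gr0I not_less_iff_gr_or_eq of_nat_0 order_less_trans)
    have NL: "(b - a) / real N \<le> \<delta>" using N N0 \<open>\<delta> > 0\<close> by (simp add: field_simps)
    show "\<exists>N. \<forall>n\<ge>N. \<bar>riemann_sum f g m t - grid_sum n f\<bar> \<le> 2 * A * young_error \<delta>"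
    proof (intro exI[of _ N] allI impI)
      fix n assume n: "N \<le> n"
      have "\<forall>i<n. grid n (Suc i) - grid n i \<le> \<delta>"
        using step_le[OF N0 n] NL by (meson order_trans)
      then show "\<bar>riemann_sum f g m t - grid_sum n f\<bar> \<le> 2 * A * young_error \<delta>"
        using riemann_sum_close[OF f t grid_partition] n N0 by auto
    qed
  qed
  then show ?thesis by blast
qed

abbreviation J :: "(real \<Rightarrow> real) \<Rightarrow> real" where
  "J f \<equiv> young_integral a b f g"

lemma young_integral_error:
  assumes f: "hol A f"
    and t: "is_partition a b m t" "\<forall>i<m. t (Suc i) - t i \<le> \<delta>"
  shows "\<bar>riemann_sum f g m t - J f\<bar> \<le> 2 * A * young_error \<delta>"
proof -
  have A: "0 \<le> A" using f by (simp add: holder_boundD)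
  obtain L where L: "\<And>m t \<delta>. is_partition a b m t \<Longrightarrow> (\<forall>i<m. t (Suc i) - t i \<le> \<delta>) \<Longrightarrow>
      \<bar>riemann_sum f g m t - L\<bar> \<le> 2 * A * young_error \<delta>"
    using young_limit_exists[OF f] by blast
  have "has_young_integral f g a b L"
    unfolding has_young_integral_def
  proof (intro allI impI)
    fix e :: real assume e: "0 < e"
    have "(\<lambda>n. A * grid_error n) \<longlonglongrightarrow> A * 0"
      by (intro tendsto_intros grid_error_tendsto)
    then have "\<forall>\<^sub>F n in sequentially. A * grid_error n < e"
      using e by (auto dest: order_tendstoD)
    then obtain N where N: "\<And>n. N \<le> n \<Longrightarrow> A * grid_error n < e"
      by (auto simp: eventually_sequentially)
    define \<delta> where "\<delta> = (b - a) / real (Suc N)"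
    have d: "\<delta> > 0" using ab by (simp add: \<delta>_def)
    have "2 * A * young_error \<delta> < e"
      using N[of "Suc N"] by (simp add: grid_error_def \<delta>_def algebra_simps)
    then show "\<exists>\<delta>>0. \<forall>m t. is_partition a b m t \<longrightarrow> (\<forall>i<m. t (Suc i) - t i < \<delta>) \<longrightarrow>
        \<bar>(\<Sum>i<m. f (t i) * (g (t (Suc i)) - g (t i))) - L\<bar> < e"
      using d L[of _ _ \<delta>, unfolded riemann_sum_def] by (meson le_less_trans less_imp_le)
  qed
  then have "J f = L" by (rule young_integral_eq[OF ab])
  then show ?thesis using L[OF t] by simp
qed

lemma grid_sum_error:
  assumes "hol A f" "0 < n"
  shows "\<bar>grid_sum n f - J f\<bar> \<le> A * grid_error n"
  using young_integral_error[OF assms(1) grid_partition[OF assms(2)], of "(b - a) / real n"]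
  by (simp add: grid_error_def grid_step mult.assoc mult.left_commute)

lemma grid_sum_tendsto:
  assumes "hol A f"
  shows "(\<lambda>n. grid_sum n f) \<longlonglongrightarrow> J f"
proof -
  have 0: "(\<lambda>n. A * grid_error n) \<longlonglongrightarrow> 0"
    using tendsto_mult_left[OF grid_error_tendsto, of A] by simp
  have "(\<lambda>n. grid_sum n f - J f) \<longlonglongrightarrow> 0"
    by (rule Lim_null_comparison[OF _ 0])
       (use grid_sum_error[OF assms] in \<open>auto simp: eventually_sequentially intro!: exI[of _ 1]\<close>)
  then show ?thesis by (simp add: LIM_zero_iff)
qed

section \<open>Linearity and pointwise continuity of the Young integral\<close>

lemma hol_add: "hol A f \<Longrightarrow> hol B h \<Longrightarrow> hol (A + B) (\<lambda>x. f x + h x)"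
  unfolding holder_bound_def
proof (intro conjI ballI; elim conjE)
  fix s t assume "s \<in> {a..b}" "t \<in> {a..b}"
    and "\<forall>s\<in>{a..b}. \<forall>t\<in>{a..b}. \<bar>f t - f s\<bar> \<le> A * \<bar>t - s\<bar> powr \<alpha>"
    and "\<forall>s\<in>{a..b}. \<forall>t\<in>{a..b}. \<bar>h t - h s\<bar> \<le> B * \<bar>t - s\<bar> powr \<alpha>"
  then have "\<bar>f t - f s\<bar> \<le> A * \<bar>t - s\<bar> powr \<alpha>" "\<bar>h t - h s\<bar> \<le> B * \<bar>t - s\<bar> powr \<alpha>"
    by blast+
  then show "\<bar>f t + h t - (f s + h s)\<bar> \<le> (A + B) * \<bar>t - s\<bar> powr \<alpha>"
    unfolding distrib_right by linarith
qed simp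

lemma hol_scale: "hol A f \<Longrightarrow> hol (\<bar>k\<bar> * A) (\<lambda>x. k * f x)"
  unfolding holder_bound_def
  by (auto simp: abs_mult mult_left_mono mult.assoc simp flip: right_diff_distrib)

lemma hol_const: "hol 0 (\<lambda>_. k)"
  by (simp add: holder_bound_def)

lemma hol_mono: "hol A f \<Longrightarrow> A \<le> B \<Longrightarrow> hol B f"
  unfolding holder_bound_def by (meson mult_right_mono order_trans powr_ge_zero)

lemma young_add:
  assumes "hol A f" "hol B h"
  shows "J (\<lambda>x. f x + h x) = J f + J h"
proof -
  have "(\<lambda>n. grid_sum n f + grid_sum n h) \<longlonglongrightarrow> J f + J h"
    by (intro tendsto_add grid_sum_tendsto[OF assms(1)] grid_sum_tendsto[OF assms(2)])
  moreover have "grid_sum n (\<lambda>x. f x + h x) = grid_sum n f + grid_sum n h" for n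
    by (simp add: riemann_sum_def distrib_right sum.distrib)
  ultimately show ?thesis
    using LIMSEQ_unique[OF grid_sum_tendsto[OF hol_add[OF assms]]] by auto
qed

lemma young_scale:
  assumes "hol A f"
  shows "J (\<lambda>x. k * f x) = k * J f"
proof -
  have "(\<lambda>n. k * grid_sum n f) \<longlonglongrightarrow> k * J f"
    by (intro tendsto_mult_left grid_sum_tendsto[OF assms])
  moreover have "grid_sum n (\<lambda>x. k * f x) = k * grid_sum n f" for n
    by (simp add: riemann_sum_def sum_distrib_left mult.assoc)
  ultimately show ?thesis
    using LIMSEQ_unique[OF grid_sum_tendsto[OF hol_scale[OF assms]]] by auto
qed

text \<open>One grid is fixed first, with error below \<open>e / 3\<close> for all functions of
  constant \<open>A\<close>; on it only finitely many values of \<open>f k\<close> enter, so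
  pointwise convergence suffices.\<close>

lemma young_pointwise_continuous:
  assumes f: "\<And>k. hol A (f k)" and h: "hol A h"
    and lim: "\<And>x. x \<in> {a..b} \<Longrightarrow> (\<lambda>k. f k x) \<longlonglongrightarrow> h x"
  shows "(\<lambda>k. J (f k)) \<longlonglongrightarrow> J h"
proof (rule LIMSEQ_I)
  fix e :: real assume e: "0 < e"
  have "(\<lambda>n. A * grid_error n) \<longlonglongrightarrow> A * 0"
    by (intro tendsto_intros grid_error_tendsto)
  then have "\<forall>\<^sub>F n in sequentially. A * grid_error n < e / 3"
    using e by (intro order_tendstoD(2)[where y="A * 0"]) auto
  then obtain N where N: "\<And>n. N \<le> n \<Longrightarrow> A * grid_error n < e / 3"
    by (auto simp: eventually_sequentially)
  define n where "n = Suc N"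
  have n: "0 < n" "A * grid_error n < e / 3" using N by (auto simp: n_def)
  have "(\<lambda>k. grid_sum n (f k)) \<longlonglongrightarrow> grid_sum n h"
    unfolding riemann_sum_def by (intro tendsto_intros lim grid_in n) auto
  then obtain K where K: "\<And>k. K \<le> k \<Longrightarrow> norm (grid_sum n (f k) - grid_sum n h) < e / 3"
    using e LIMSEQ_D[where r="e / 3"] by (metis divide_pos_pos zero_less_numeral)
  show "\<exists>no. \<forall>k\<ge>no. norm (J (f k) - J h) < e"
  proof (intro exI[of _ K] allI impI)
    fix k assume "K \<le> k"
    then show "norm (J (f k) - J h) < e"
      using K[of k] grid_sum_error[OF f[of k] n(1)] grid_sum_error[OF h n(1)] n(2)
      unfolding real_norm_def by linarith
  qed
qed

end

subsection \<open>Extension and approximation of Hoelder functions\<close>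

text \<open>Concavity enters as \<open>u \<le> u powr p\<close> on \<open>[0,1]\<close>, applied to
  the fractions of \<open>x\<close> and \<open>y\<close> in \<open>x + y\<close>.\<close>

lemma powr_subadditive:
  fixes x y p :: real
  assumes "0 \<le> x" "0 \<le> y" "0 < p" "p \<le> 1"
  shows "(x + y) powr p \<le> x powr p + y powr p"
proof (cases "x + y = 0")
  case True
  then show ?thesis using assms by simp
next
  case False
  then have pos: "0 < x + y" using assms by linarith
  have ge: "u \<le> u powr p" if "0 \<le> u" "u \<le> 1" for u :: real
  proof (cases "u = 0")
    case False
    then have "u powr 1 \<le> u powr p"
      using that assms by (intro powr_mono') auto
    then show ?thesis using that by simp
  qed (use assms in simp)
  have "1 = x / (x + y) + y / (x + y)"
    using pos by (simp flip: add_divide_distrib)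
  also have "\<dots> \<le> (x / (x + y)) powr p + (y / (x + y)) powr p"
    using assms pos by (intro add_mono ge) auto
  also have "\<dots> = (x powr p + y powr p) / (x + y) powr p"
    using assms by (simp add: powr_divide add_divide_distrib)
  finally show ?thesis using pos by (simp add: le_divide_eq)
qed

lemma powr_dist_triangle:
  fixes x y z p :: real
  assumes "0 < p" "p \<le> 1"
  shows "\<bar>x - z\<bar> powr p \<le> \<bar>x - y\<bar> powr p + \<bar>y - z\<bar> powr p"
proof -
  have "\<bar>x - z\<bar> powr p \<le> (\<bar>x - y\<bar> + \<bar>y - z\<bar>) powr p"
    using assms by (intro powr_mono2) auto
  also have "\<dots> \<le> \<bar>x - y\<bar> powr p + \<bar>y - z\<bar> powr p"
    using assms by (intro powr_subadditive) auto
  finally show ?thesis .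
qed

text \<open>McShane's formula: \<open>\<bar>x - y\<bar> powr p\<close> is a metric, and the lower
  envelope of the cones over the data points is \<open>L\<close>-Lipschitz for it.\<close>

lemma mcshane_extension:
  fixes l :: "real \<Rightarrow> real"
  assumes X: "finite X" "X \<noteq> {}" and p: "0 < p" "p \<le> 1" and L: "0 \<le> L"
    and l: "\<And>s t. s \<in> X \<Longrightarrow> t \<in> X \<Longrightarrow> l t - l s \<le> L * \<bar>t - s\<bar> powr p"
  shows "\<exists>f. (\<forall>x\<in>X. f x = l x) \<and> (\<forall>I. holder_bound L p I f)"
proof -
  define f where "f x = Min ((\<lambda>s. l s + L * \<bar>x - s\<bar> powr p) ` X)" for x
  have lower: "f x \<le> l s + L * \<bar>x - s\<bar> powr p" if "s \<in> X" for s x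
    unfolding f_def using X that by (intro Min_le) auto
  have attain: "\<exists>s\<in>X. f x = l s + L * \<bar>x - s\<bar> powr p" for x
  proof -
    have "f x \<in> (\<lambda>s. l s + L * \<bar>x - s\<bar> powr p) ` X"
      unfolding f_def using X by (intro Min_in) auto
    then show ?thesis by blast
  qed
  have "f x = l x" if "x \<in> X" for x
  proof (rule antisym)
    show "f x \<le> l x" using lower[OF that, of x] p by simp
    obtain s where "s \<in> X" "f x = l s + L * \<bar>x - s\<bar> powr p" using attain by blast
    then show "l x \<le> f x" using l[of s x] that by simp
  qed
  moreover have "f t - f s \<le> L * \<bar>t - s\<bar> powr p" for s t
  proof -
    obtain r where r: "r \<in> X" "f s = l r + L * \<bar>s - r\<bar> powr p" using attain by blast
    have "f t \<le> l r + L * \<bar>t - r\<bar> powr p" by (rule lower[OF r(1)])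
    also have "L * \<bar>t - r\<bar> powr p \<le> L * (\<bar>t - s\<bar> powr p + \<bar>s - r\<bar> powr p)"
      using L p by (intro mult_left_mono powr_dist_triangle) auto
    finally show ?thesis using r(2) by (simp add: distrib_left)
  qed
  then have "\<bar>f t - f s\<bar> \<le> L * \<bar>t - s\<bar> powr p" for s t
    by (metis abs_le_iff abs_minus_commute minus_diff_eq)
  ultimately show ?thesis using L by (auto simp: holder_bound_def)
qed

text \<open>Inf-convolution with \<open>k * \<bar>z\<bar>\<close>: as an infimum of translates of
  \<open>F\<close> plus constants it keeps the Hoelder bound, as an infimum of cones it is
  \<open>k\<close>-Lipschitz. Keeping the same \<open>A\<close> makes
  \<open>young_pointwise_continuous\<close> applicable to the approximants.\<close>

lemma lipschitz_approximation:
  fixes f :: "real \<Rightarrow> real"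
  assumes f: "holder_bound A p {a..b} f" and p: "0 < p" "p \<le> 1" and ab: "a \<le> b"
  obtains h :: "nat \<Rightarrow> real \<Rightarrow> real" where
    "\<And>k. holder_bound A p {a..b} (h k)"
    "\<And>k s t. \<bar>h k t - h k s\<bar> \<le> real k * \<bar>t - s\<bar>"
    "\<And>x. x \<in> {a..b} \<Longrightarrow> (\<lambda>k. h k x) \<longlonglongrightarrow> f x"
proof -
  have A: "0 \<le> A" using f by (simp add: holder_boundD)
  \<comment> \<open>Constant extension beyond the end points, so that the shift \<open>z\<close> can
    range over all reals.\<close>
  define F where "F x = f (max a (min b x))" for x
  have Fh: "\<bar>F t - F s\<bar> \<le> A * \<bar>t - s\<bar> powr p" for s t
  proof -
    have "\<bar>F t - F s\<bar> \<le> A * \<bar>max a (min b t) - max a (min b s)\<bar> powr p"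
      unfolding F_def using ab by (intro holder_boundD(1)[OF f]) auto
    also have "\<dots> \<le> A * \<bar>t - s\<bar> powr p"
      using A p by (intro mult_left_mono powr_mono2) auto
    finally show ?thesis .
  qed
  define B where "B = \<bar>f a\<bar> + A * (b - a) powr p"
  have FB: "- B \<le> F x" for x
  proof -
    have "\<bar>F x - F a\<bar> \<le> A * \<bar>max a (min b x) - a\<bar> powr p"
      unfolding F_def using ab by (intro order_trans[OF holder_boundD(1)[OF f]]) auto
    also have "\<dots> \<le> A * (b - a) powr p"
      using A p ab by (intro mult_left_mono powr_mono2) auto
    finally show ?thesis using ab unfolding B_def F_def by auto
  qed
  define h where "h k x = (INF z. F (x + z) + real k * \<bar>z\<bar>)" for k :: nat and x
  have bdd: "bdd_below (range (\<lambda>z. F (x + z) + real k * \<bar>z\<bar>))" for x and k :: nat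
    using FB by (intro bdd_belowI[of _ "- B"]) (auto intro: add_increasing2)
  have h_le: "h k x \<le> F (x + z) + real k * \<bar>z\<bar>" for k x z
    unfolding h_def by (rule cINF_lower[OF bdd]) simp
  have h_ge: "m \<le> h k x" if "\<And>z. m \<le> F (x + z) + real k * \<bar>z\<bar>" for m k x
    unfolding h_def using that by (intro cINF_greatest) auto
  have "h k s - A * \<bar>t - s\<bar> powr p \<le> h k t" for k s t
  proof (rule h_ge)
    fix z
    show "h k s - A * \<bar>t - s\<bar> powr p \<le> F (t + z) + real k * \<bar>z\<bar>"
      using h_le[of k s z] Fh[of "t + z" "s + z"] by simp
  qed
  then have hol: "\<bar>h k t - h k s\<bar> \<le> A * \<bar>t - s\<bar> powr p" for k s t
    by (metis abs_diff_le_iff abs_minus_commute add.commute diff_le_eq)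
  have "h k s - real k * \<bar>t - s\<bar> \<le> h k t" for k s t
  proof (rule h_ge)
    fix z
    have "real k * \<bar>t + z - s\<bar> \<le> real k * (\<bar>z\<bar> + \<bar>t - s\<bar>)"
      by (intro mult_left_mono) auto
    then show "h k s - real k * \<bar>t - s\<bar> \<le> F (t + z) + real k * \<bar>z\<bar>"
      using h_le[of k s "t + z - s"] by (simp add: distrib_left)
  qed
  then have lip: "\<bar>h k t - h k s\<bar> \<le> real k * \<bar>t - s\<bar>" for k s t
    by (metis abs_diff_le_iff abs_minus_commute add.commute diff_le_eq)
  have lim: "(\<lambda>k. h k x) \<longlonglongrightarrow> F x" for x
  proof (rule LIMSEQ_I)
    fix e :: real assume e: "0 < e"
    \<comment> \<open>Up to distance \<open>d\<close> the Hoelder bound is at most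
      \<open>e / 2\<close>; beyond it the power lies below the line of slope
      \<open>A * d powr (p - 1)\<close>, hence below \<open>k * \<bar>z\<bar>\<close> for large
      \<open>k\<close>. The \<open>+ 1\<close> covers \<open>A = 0\<close>.\<close>
    define d where "d = (e / (2 * (A + 1))) powr (1 / p)"
    have d0: "0 < d" using e A by (simp add: d_def)
    have "A * d powr p = A * (e / (2 * (A + 1)))"
      using p e A by (simp add: d_def powr_powr)
    also have "\<dots> \<le> e / 2" using e A by (simp add: field_simps)
    finally have d: "A * d powr p \<le> e / 2" .
    obtain N :: nat where N: "A * d powr (p - 1) \<le> real N"
      using real_arch_simple by blast
    show "\<exists>no. \<forall>k\<ge>no. norm (h k x - F x) < e"
    proof (intro exI[of _ N] allI impI)
      fix k assume k: "N \<le> k"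
      have "F x - e / 2 \<le> h k x"
      proof (rule h_ge)
        fix z
        have "A * \<bar>z\<bar> powr p \<le> e / 2 + real k * \<bar>z\<bar>"
        proof (cases "\<bar>z\<bar> \<le> d")
          case True
          then have "A * \<bar>z\<bar> powr p \<le> A * d powr p"
            using A p by (intro mult_left_mono powr_mono2) auto
          then show ?thesis using d by (smt (verit) mult_nonneg_nonneg of_nat_0_le_iff)
        next
          case False
          have "\<bar>z\<bar> powr p = \<bar>z\<bar> powr (p - 1) * \<bar>z\<bar>"
            using False d0 by (simp add: powr_diff)
          also have "\<dots> \<le> d powr (p - 1) * \<bar>z\<bar>"
            using False d0 p by (intro mult_right_mono powr_mono2') auto
          finally have "A * \<bar>z\<bar> powr p \<le> (A * d powr (p - 1)) * \<bar>z\<bar>"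
            using A by (simp add: mult_left_mono mult.assoc)
          also have "\<dots> \<le> real k * \<bar>z\<bar>"
            using N k by (intro mult_right_mono) auto
          finally show ?thesis using e by simp
        qed
        then show "F x - e / 2 \<le> F (x + z) + real k * \<bar>z\<bar>"
          using Fh[of "x + z" x] by simp
      qed
      moreover have "h k x \<le> F x" using h_le[of k x 0] by simp
      ultimately show "norm (h k x - F x) < e" using e by simp
    qed
  qed
  show ?thesis
  proof (rule that[of h])
    show "holder_bound A p {a..b} (h k)" for k
      using A hol by (simp add: holder_bound_def)
    show "\<bar>h k t - h k s\<bar> \<le> real k * \<bar>t - s\<bar>" for k s t by (rule lip)
    show "(\<lambda>k. h k x) \<longlonglongrightarrow> f x" if "x \<in> {a..b}" for x
      using lim[of x] that by (simp add: F_def max_absorb2 min_absorb2)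
  qed
qed

subsection \<open>A space-filling curve and compactness of probability measures on a square\<close>

text \<open>The digits come from the doubling map, whose remainder stays in \<open>[0,1]\<close>;
  the closed test at one half gives the point \<open>1\<close> the expansion with all digits
  one.\<close>

lemma binary_expansion:
  fixes x :: real
  assumes "x \<in> {0..1}"
  shows "\<exists>d :: nat \<Rightarrow> bool. (\<lambda>n. of_bool (d n) / 2 ^ Suc n) sums x"
proof -
  define r where "r = rec_nat x (\<lambda>_ y. 2 * y - of_bool (1 / 2 \<le> y))"
  define d where "d n \<longleftrightarrow> 1 / 2 \<le> r n" for n
  have r0: "r 0 = x" and rS: "r (Suc n) = 2 * r n - of_bool (d n)" for n
    by (simp_all add: r_def d_def)
  have r01: "r n \<in> {0..1}" for n
    by (induction n) (use assms in \<open>auto simp: r0 rS d_def\<close>)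
  have partial: "(\<Sum>k<n. of_bool (d k) / 2 ^ Suc k) = x - r n / 2 ^ n" for n
    by (induction n) (auto simp: r0 rS field_simps)
  have "(\<lambda>n. r n / 2 ^ n) \<longlonglongrightarrow> 0"
  proof (rule Lim_null_comparison)
    show "\<forall>\<^sub>F n in sequentially. norm (r n / 2 ^ n) \<le> (1 / 2) ^ n"
      using r01 by (intro always_eventually) (auto simp: field_simps)
    show "(\<lambda>n. (1 / 2 :: real) ^ n) \<longlonglongrightarrow> 0" by (rule LIMSEQ_power_zero) simp
  qed
  then have "(\<lambda>n. x - r n / 2 ^ n) \<longlonglongrightarrow> x - 0" by (intro tendsto_intros)
  then have "(\<lambda>n. of_bool (d n) / 2 ^ Suc n) sums x"
    unfolding sums_def partial by simp
  then show ?thesis by blast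
qed

text \<open>Schoenberg's auxiliary function: period two, zero on \<open>[0,1/3]\<close>, one on
  \<open>[2/3,1]\<close>. Truncating a cosine makes continuity and periodicity immediate.\<close>

definition schoenberg_wave :: "real \<Rightarrow> real" where
  "schoenberg_wave x = max 0 (min 1 (1 / 2 - cos (pi * x)))"

lemma schoenberg_wave_digit:
  assumes "0 \<le> y" "y \<le> 1 / 3"
  shows "schoenberg_wave (2 * real_of_int N + (2 * of_bool c / 3 + y)) = of_bool c"
proof -
  have period: "cos (pi * (2 * real_of_int N + z)) = cos (pi * z)" for z
  proof -
    have "cos (pi * (2 * real_of_int N + z)) = cos (pi * z + real_of_int N * (2 * pi))"
      by (simp add: algebra_simps)
    also have "\<dots> = cos (pi * z)"
      using cos_int_2pin sin_int_2pin by (simp add: cos_add mult.commute)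
    finally show ?thesis .
  qed
  have small: "1 / 2 \<le> cos (pi * z)" if "0 \<le> z" "z \<le> 1 / 3" for z :: real
  proof -
    have "pi * z \<le> pi * (1 / 3)" using that by (intro mult_left_mono) auto
    then have "cos (pi / 3) \<le> cos (pi * z)"
      using that by (intro cos_monotone_0_pi_le) auto
    then show ?thesis by (simp add: cos_60)
  qed
  show ?thesis
  proof (cases c)
    case True
    have "cos (pi * (2 / 3 + y)) = - cos (pi * (1 / 3 - y))"
      using cos_minus_pi[of "pi * (2 / 3 + y)"] cos_minus[of "pi * (1 / 3 - y)"]
      by (simp add: algebra_simps)
    then have "cos (pi * (2 / 3 + y)) \<le> - 1 / 2"
      using small[of "1 / 3 - y"] assms by simp
    then show ?thesis using True by (simp add: schoenberg_wave_def period)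
  next
    case False
    then show ?thesis using small[OF assms] by (simp add: schoenberg_wave_def period)
  qed
qed

lemma schoenberg_series_continuous:
  "continuous_on UNIV (\<lambda>t. \<Sum>n. schoenberg_wave (k * 9 ^ n * t) / 2 ^ Suc n)"
proof (rule uniform_limit_theorem[where F=sequentially])
  show "uniform_limit UNIV (\<lambda>n t. \<Sum>i<n. schoenberg_wave (k * 9 ^ i * t) / 2 ^ Suc i)
      (\<lambda>t. \<Sum>n. schoenberg_wave (k * 9 ^ n * t) / 2 ^ Suc n) sequentially"
  proof (rule Weierstrass_m_test)
    show "norm (schoenberg_wave (k * 9 ^ n * t) / 2 ^ Suc n) \<le> (1 / 2) ^ n" for n t
      by (auto simp: schoenberg_wave_def field_simps)
    show "summable (\<lambda>n. (1 / 2 :: real) ^ n)" by (rule summable_geometric) simp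
  qed
  show "\<forall>\<^sub>F n in sequentially. continuous_on UNIV (\<lambda>t. \<Sum>i<n. schoenberg_wave (k * 9 ^ i * t) / 2 ^ Suc i)"
    unfolding schoenberg_wave_def by (intro always_eventually allI continuous_intros) auto
qed simp

lemma schoenberg_series_range:
  "(\<Sum>n. schoenberg_wave (k * 9 ^ n * t) / 2 ^ Suc n) \<in> {0..1}"
proof -
  have g: "(\<lambda>n. (1 / 2 :: real) ^ Suc n) sums 1" by (rule power_half_series)
  have b: "0 \<le> schoenberg_wave (k * 9 ^ n * t) / 2 ^ Suc n"
    "schoenberg_wave (k * 9 ^ n * t) / 2 ^ Suc n \<le> (1 / 2) ^ Suc n" for n
    by (auto simp: schoenberg_wave_def field_simps)
  have nb: "norm (schoenberg_wave (k * 9 ^ n * t) / 2 ^ Suc n) \<le> (1 / 2) ^ Suc n" for n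
    using b[of n] by (simp only: real_norm_def abs_of_nonneg)
  have s: "summable (\<lambda>n. schoenberg_wave (k * 9 ^ n * t) / 2 ^ Suc n)"
    by (rule summable_comparison_test'[OF sums_summable[OF g], of 0]) (rule nb)
  show ?thesis
    using suminf_nonneg[OF s] suminf_le[OF _ s sums_summable[OF g]] b sums_unique[OF g] by auto
qed

text \<open>Schoenberg's space-filling curve, scaled to \<open>[a,b]\<times>[a,b]\<close>: the ternary digits of \<open>t / 2\<close>
  interleave the binary digits of the two coordinates.\<close>

lemma square_filling_curve:
  fixes a b :: real
  assumes "a < b"
  obtains \<phi> :: "real \<Rightarrow> real \<times> real" where
    "continuous_on UNIV \<phi>" "\<And>t. \<phi> t \<in> {a..b} \<times> {a..b}"
    "\<And>z. z \<in> {a..b} \<times> {a..b} \<Longrightarrow> \<exists>t\<in>{0..1}. \<phi> t = z"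
proof -
  define S where "S k t = (\<Sum>n. schoenberg_wave (k * 9 ^ n * t) / 2 ^ Suc n)" for k t :: real
  define \<phi> where "\<phi> t = (a + (b - a) * S 1 t, a + (b - a) * S 3 t)" for t
  have cont: "continuous_on UNIV \<phi>"
    unfolding \<phi>_def S_def by (intro continuous_intros schoenberg_series_continuous)
  have S01: "S k t \<in> {0..1}" for k t
    unfolding S_def by (rule schoenberg_series_range)
  have "a + (b - a) * S k t \<in> {a..b}" for k t
  proof -
    have "0 \<le> (b - a) * S k t" "(b - a) * S k t \<le> (b - a) * 1"
      using S01[of k t] assms by (auto intro!: mult_left_mono)
    then show ?thesis by simp
  qed
  then have range: "\<phi> t \<in> {a..b} \<times> {a..b}" for t by (simp add: \<phi>_def del: atLeastAtMost_iff)
  have unit: "\<exists>t\<in>{0..1}. S 1 t = x \<and> S 3 t = y" if xy: "x \<in> {0..1}" "y \<in> {0..1}" for x y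
  proof -
    obtain dx dy :: "nat \<Rightarrow> bool" where dx: "(\<lambda>n. of_bool (dx n) / 2 ^ Suc n) sums x"
      and dy: "(\<lambda>n. of_bool (dy n) / 2 ^ Suc n) sums y"
      using binary_expansion xy by metis
    define c where "c n = (if even n then dx (n div 2) else dy (n div 2))" for n :: nat
    \<comment> \<open>The number with ternary digits \<open>2 * c\<close>, read from position
      \<open>k\<close>; \<open>T 0\<close> is the parameter mapped to \<open>(x, y)\<close>.\<close>
    define T where "T k = (\<Sum>j. 2 * of_bool (c (k + j)) / 3 ^ Suc j :: real)" for k
    have geo: "(\<lambda>j. 2 / 3 ^ Suc j :: real) sums 1"
      using sums_mult[OF geometric_sums[of "1 / 3 :: real"], of "2 / 3"]
      by (simp add: power_divide)
    have sm: "summable (\<lambda>j. 2 * of_bool (c (k + j)) / 3 ^ Suc j :: real)" for k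
      by (rule summable_comparison_test'[OF sums_summable[OF geo], of 0]) auto
    have T0: "0 \<le> T k" for k unfolding T_def by (intro suminf_nonneg sm) auto
    have T1: "T k \<le> 1" for k
      unfolding T_def sums_unique[OF geo] by (intro suminf_le sm sums_summable[OF geo]) auto
    have Tstep: "T k = 2 * of_bool (c k) / 3 + T (Suc k) / 3" for k
    proof -
      have "T k = 2 * of_bool (c k) / 3 + (\<Sum>j. 2 * of_bool (c (k + Suc j)) / 3 ^ Suc (Suc j))"
        using suminf_split_head[OF sm[of k]] by (simp add: T_def)
      also have "(\<Sum>j. 2 * of_bool (c (k + Suc j)) / 3 ^ Suc (Suc j) :: real)
          = (\<Sum>j. (2 * of_bool (c (Suc k + j)) / 3 ^ Suc j) / 3)"
        by (intro suminf_cong) simp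
      also have "\<dots> = T (Suc k) / 3"
        unfolding T_def by (rule suminf_divide[OF sm])
      finally show ?thesis .
    qed
    \<comment> \<open>Multiplication by three shifts the digits. As these are \<open>0\<close> or
      \<open>2\<close>, the integer split off is even and disappears in the period of the
      wave.\<close>
    have "\<exists>N :: int. 3 ^ k * T 0 = 2 * of_int N + T k" for k
    proof (induction k)
      case 0
      show ?case by (rule exI[of _ 0]) simp
    next
      case (Suc k)
      then obtain N :: int where N: "3 ^ k * T 0 = 2 * of_int N + T k" by blast
      have "3 ^ Suc k * T 0 = 3 * (3 ^ k * T 0)" by simp
      also have "\<dots> = 2 * of_int (3 * N + of_bool (c k)) + T (Suc k)"
        unfolding N by (subst Tstep) (simp add: algebra_simps)
      finally show ?case by blast
    qed
    then have digit: "schoenberg_wave (3 ^ k * T 0) = of_bool (c k)" for k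
      using schoenberg_wave_digit[of "T (Suc k) / 3" _ "c k"] T0[of "Suc k"] T1[of "Suc k"] Tstep[of k]
      by (metis divide_right_mono divide_nonneg_nonneg zero_le_numeral)
    \<comment> \<open>The factors \<open>9 ^ n\<close> and \<open>3 * 9 ^ n\<close> read the even
      and odd positions, which hold the digits of \<open>x\<close> and of \<open>y\<close>.\<close>
    have "1 * 9 ^ n * T 0 = 3 ^ (2 * n) * T 0" "3 * 9 ^ n * T 0 = 3 ^ Suc (2 * n) * T 0" for n
      by (simp_all add: power_mult)
    then have "S 1 (T 0) = (\<Sum>n. of_bool (c (2 * n)) / 2 ^ Suc n)"
      "S 3 (T 0) = (\<Sum>n. of_bool (c (Suc (2 * n))) / 2 ^ Suc n)"
      unfolding S_def digit[symmetric] by presburger+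
    then have "S 1 (T 0) = x" "S 3 (T 0) = y"
      using sums_unique[OF dx] sums_unique[OF dy] by (simp_all add: c_def)
    then show ?thesis using T0[of 0] T1[of 0] by auto
  qed
  have "\<exists>t\<in>{0..1}. \<phi> t = z" if "z \<in> {a..b} \<times> {a..b}" for z
  proof -
    have "(fst z - a) / (b - a) \<in> {0..1}" "(snd z - a) / (b - a) \<in> {0..1}"
      using that assms by (auto simp: mem_Times_iff)
    then obtain t where "t \<in> {0..1}" "S 1 t = (fst z - a) / (b - a)" "S 3 t = (snd z - a) / (b - a)"
      using unit by blast
    then show ?thesis using assms by (intro bexI[of _ t]) (auto simp: \<phi>_def)
  qed
  then show ?thesis using that cont range by blast
qed

text \<open>A right inverse \<open>\<psi>\<close> of the space-filling curve carries the measures to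
  \<open>[0,1]\<close>, where tightness is automatic; the weak limit on the line is pushed back by
  \<open>\<phi>\<close>. Discontinuities of \<open>\<psi>\<close> are harmless: only
  \<open>F \<circ> \<phi>\<close> is tested, and \<open>\<phi> \<circ> \<psi>\<close> is the
  identity on the square. Every map is measurable for a \<open>pmf\<close>.\<close>

lemma pmf_square_compact:
  fixes a b :: real and p :: "nat \<Rightarrow> (real \<times> real) pmf"
  assumes ab: "a < b" and p: "\<And>n. set_pmf (p n) \<subseteq> {a..b} \<times> {a..b}"
  obtains r :: "nat \<Rightarrow> nat" and N :: "(real \<times> real) measure" where
    "strict_mono r" "prob_space N" "sets N = sets (restrict_space borel ({a..b} \<times> {a..b}))"
    "\<And>F :: real \<times> real \<Rightarrow> real. continuous_on ({a..b} \<times> {a..b}) F \<Longrightarrow>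
       (\<lambda>n. measure_pmf.expectation (p (r n)) F) \<longlonglongrightarrow> integral\<^sup>L N F"
proof -
  define S where "S = {a..b} \<times> {a..b}"
  obtain \<phi> :: "real \<Rightarrow> real \<times> real" where \<phi>: "continuous_on UNIV \<phi>" "\<And>t. \<phi> t \<in> S"
    "\<And>z. z \<in> S \<Longrightarrow> \<exists>t\<in>{0..1}. \<phi> t = z"
    using square_filling_curve[OF ab] unfolding S_def by metis
  define \<psi> where "\<psi> z = (SOME t. t \<in> {0..1} \<and> \<phi> t = z)" for z
  have \<psi>: "\<psi> z \<in> {0..1}" "\<phi> (\<psi> z) = z" if "z \<in> S" for z
    using someI_ex[of "\<lambda>t. t \<in> {0..1} \<and> \<phi> t = z"] \<phi>(3)[OF that] unfolding \<psi>_def by blast+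
  define \<mu> where "\<mu> n = distr (measure_pmf (p n)) borel \<psi>" for n
  have rd: "real_distribution (\<mu> n)" for n
    unfolding \<mu>_def real_distribution_def real_distribution_axioms_def
    by (auto intro: measure_pmf.prob_space_distr)
  \<comment> \<open>The interval is open on the left, so it starts below zero to contain the whole
    range \<open>[0,1]\<close> of \<open>\<psi>\<close>.\<close>
  have "measure (\<mu> n) {-1<..1} = 1" for n
  proof -
    have "AE z in measure_pmf (p n). z \<in> \<psi> -` {-1<..1}"
      using p \<psi>(1) by (force simp: AE_measure_pmf_iff S_def)
    then have "measure (measure_pmf (p n)) (\<psi> -` {-1<..1}) = 1"
      by (subst measure_pmf.prob_eq_1) auto
    then show ?thesis by (simp add: \<mu>_def measure_distr)
  qed
  then have "\<exists>u v :: real. u < v \<and> (\<forall>n. measure (\<mu> n) {u<..v} > 1 - e)" if "0 < e" for e :: real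
    using that by (intro exI[of _ "-1"] exI[of _ 1]) simp
  then have "tight \<mu>"
    unfolding tight_def using rd by blast
  then obtain r :: "nat \<Rightarrow> nat" and M where r: "strict_mono r" and M: "real_distribution M"
    and conv: "weak_conv_m (\<mu> \<circ> id \<circ> r) M"
    using tight_imp_convergent_subsubsequence[of \<mu> id] by (auto simp: strict_mono_def)
  interpret M: real_distribution M by (rule M)
  define N where "N = distr M (restrict_space borel S) \<phi>"
  have \<phi>_meas: "\<phi> \<in> measurable M (restrict_space borel S)"
    using \<phi>(2) borel_measurable_continuous_onI[OF \<phi>(1)]
    by (intro measurable_restrict_space2) (auto simp: measurable_def)
  show ?thesis
  proof (rule that[OF r, of N])
    show "prob_space N" unfolding N_def by (rule M.prob_space_distr[OF \<phi>_meas])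
    show "sets N = sets (restrict_space borel ({a..b} \<times> {a..b}))" by (simp add: N_def S_def)
    fix F :: "real \<times> real \<Rightarrow> real" assume "continuous_on ({a..b} \<times> {a..b}) F"
    then have F: "continuous_on S F" by (simp add: S_def)
    have comp: "continuous_on UNIV (\<lambda>t. F (\<phi> t))"
      by (rule continuous_on_compose2[OF F \<phi>(1)]) (use \<phi>(2) in auto)
    have "compact (F ` S)"
      by (rule compact_continuous_image[OF F]) (auto simp: S_def intro: compact_Times)
    then obtain B where B: "\<And>z. z \<in> S \<Longrightarrow> norm (F z) \<le> B"
      by (meson bounded_iff compact_imp_bounded imageI)
    have "(\<lambda>n. integral\<^sup>L ((\<mu> \<circ> id \<circ> r) n) (\<lambda>t. F (\<phi> t))) \<longlonglongrightarrow> integral\<^sup>L M (\<lambda>t. F (\<phi> t))"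
    proof (rule weak_conv_imp_integral_bdd_continuous_conv[OF _ M conv])
      show "real_distribution ((\<mu> \<circ> id \<circ> r) n)" for n using rd by simp
      show "isCont (\<lambda>t. F (\<phi> t)) x" for x
        using comp by (simp add: continuous_on_eq_continuous_at)
      show "norm (F (\<phi> x)) \<le> B" for x using B \<phi>(2) by blast
    qed
    moreover have "integral\<^sup>L ((\<mu> \<circ> id \<circ> r) n) (\<lambda>t. F (\<phi> t)) = measure_pmf.expectation (p (r n)) F" for n
    proof -
      have "integral\<^sup>L (\<mu> (r n)) (\<lambda>t. F (\<phi> t)) = measure_pmf.expectation (p (r n)) (\<lambda>z. F (\<phi> (\<psi> z)))"
        unfolding \<mu>_def by (rule integral_distr) (use comp in \<open>auto intro: borel_measurable_continuous_onI\<close>)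
      also have "\<dots> = measure_pmf.expectation (p (r n)) F"
      proof (rule integral_cong_AE)
        have "F (\<phi> (\<psi> z)) = F z" if "z \<in> set_pmf (p (r n))" for z
          using \<psi>(2)[of z] p[of "r n"] that unfolding S_def by auto
        then show "AE z in p (r n). F (\<phi> (\<psi> z)) = F z" by (simp add: AE_measure_pmf_iff)
      qed auto
      finally show ?thesis by simp
    qed
    moreover have "integral\<^sup>L N F = integral\<^sup>L M (\<lambda>t. F (\<phi> t))"
      unfolding N_def
      by (rule integral_distr[OF \<phi>_meas borel_measurable_continuous_on_restrict[OF F]])
    ultimately show "(\<lambda>n. measure_pmf.expectation (p (r n)) F) \<longlonglongrightarrow> integral\<^sup>L N F" by simp
  qed
qed

subsection \<open>Approximate duality and the maximiser\<close>

text \<open>Separation in finite dimension without hyperplanes: if \<open>\<delta>\<close> is the infimum of the squared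
  distance from \<open>c\<close> to the convex hull of the \<open>V z\<close>, moving a fraction \<open>e\<close> of the mass to the
  \<open>z\<close> belonging to the current residual gives \<open>\<delta> \<le> (1 - 2 e) \<delta> + O(e\<^sup>2)\<close>.\<close>

lemma convex_hull_approximation:
  fixes V :: "'z \<Rightarrow> 'i \<Rightarrow> real" and c :: "'i \<Rightarrow> real"
  assumes I: "finite I" and Z: "finite Z"
    and sep: "\<And>l. \<exists>z\<in>Z. (\<Sum>i\<in>I. l i * c i) \<le> (\<Sum>i\<in>I. l i * V z i)"
    and eps: "0 < \<epsilon>"
  shows "\<exists>w. (\<forall>z. 0 \<le> w z) \<and> sum w Z = 1 \<and> (\<Sum>i\<in>I. (c i - (\<Sum>z\<in>Z. w z * V z i))\<^sup>2) < \<epsilon>"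
proof (rule ccontr)
  assume no: "\<not> ?thesis"
  define W where "W = {w :: 'z \<Rightarrow> real. (\<forall>z. 0 \<le> w z) \<and> sum w Z = 1}"
  define E where "E w i = (\<Sum>z\<in>Z. w z * V z i)" for w i
  define D where "D w = (\<Sum>i\<in>I. (c i - E w i)\<^sup>2)" for w
  define \<delta> where "\<delta> = Inf (D ` W)"
  obtain z0 where z0: "z0 \<in> Z" using sep[of "\<lambda>_. 0"] by auto
  have dirac: "(\<lambda>z'. of_bool (z' = z)) \<in> W" if "z \<in> Z" for z
    using that Z by (simp add: W_def)
  then have W_ne: "W \<noteq> {}" using z0 by auto
  have bdd: "bdd_below (D ` W)"
    by (rule bdd_belowI[of _ 0]) (auto simp: D_def intro: sum_nonneg)
  have \<delta>_ge: "\<epsilon> \<le> \<delta>"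
    unfolding \<delta>_def using no W_ne by (intro cINF_greatest) (auto simp: W_def D_def E_def not_less)
  define B where "B = (\<Sum>z\<in>Z. \<Sum>i\<in>I. \<bar>V z i\<bar>)"
  have VB: "\<bar>V z i\<bar> \<le> B" if "z \<in> Z" "i \<in> I" for z i
  proof -
    have "\<bar>V z i\<bar> \<le> (\<Sum>i\<in>I. \<bar>V z i\<bar>)" using that I by (intro member_le_sum) auto
    also have "\<dots> \<le> B" unfolding B_def using that Z
      by (intro member_le_sum[of z Z "\<lambda>z. \<Sum>i\<in>I. \<bar>V z i\<bar>"]) (auto intro: sum_nonneg)
    finally show ?thesis .
  qed
  have EB: "\<bar>E w i\<bar> \<le> B" if "w \<in> W" "i \<in> I" for w i
  proof -
    have "\<bar>E w i\<bar> \<le> (\<Sum>z\<in>Z. w z * B)"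
      unfolding E_def using that VB
      by (intro order_trans[OF sum_abs] sum_mono) (auto simp: W_def abs_mult intro!: mult_left_mono)
    also have "\<dots> = B" using that by (simp add: W_def flip: sum_distrib_right)
    finally show ?thesis .
  qed
  define C where "C = real (card I) * (2 * B)\<^sup>2 + 1"
  have step: "\<delta> \<le> (1 - 2 * e) * D w + e\<^sup>2 * C" if w: "w \<in> W" and e: "0 < e" "e \<le> 1" for w e
  proof -
    define r where "r i = c i - E w i" for i
    obtain z where z: "z \<in> Z" "(\<Sum>i\<in>I. r i * c i) \<le> (\<Sum>i\<in>I. r i * V z i)"
      using sep[of r] by auto
    define w' where "w' = (\<lambda>z'. (1 - e) * w z' + e * of_bool (z' = z))"
    have w': "w' \<in> W"
      using w e z(1) Z unfolding W_def w'_def by (auto simp: sum.distrib simp flip: sum_distrib_left)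
    have dirac_sum: "(\<Sum>z'\<in>Z. of_bool (z' = z) * V z' i) = V z i" for i
    proof -
      have "(\<Sum>z'\<in>Z. of_bool (z' = z) * V z' i) = (\<Sum>z'\<in>Z. if z' = z then V z' i else 0)"
        by (intro sum.cong) auto
      then show ?thesis using z(1) Z by simp
    qed
    have E': "E w' i = (1 - e) * E w i + e * V z i" for i
      unfolding E_def w'_def
      by (simp only: distrib_right sum.distrib mult.assoc dirac_sum flip: sum_distrib_left)
    have "\<delta> \<le> D w'" unfolding \<delta>_def by (rule cINF_lower[OF bdd w'])
    also have "D w' = (\<Sum>i\<in>I. (r i)\<^sup>2 - 2 * e * (r i * V z i - r i * E w i) + e\<^sup>2 * (V z i - E w i)\<^sup>2)"
      unfolding D_def E' r_def by (intro sum.cong refl) (simp add: power2_eq_square algebra_simps)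
    also have "\<dots> = D w - 2 * e * ((\<Sum>i\<in>I. r i * V z i) - (\<Sum>i\<in>I. r i * E w i))
         + e\<^sup>2 * (\<Sum>i\<in>I. (V z i - E w i)\<^sup>2)"
      by (simp add: sum.distrib sum_subtractf D_def r_def flip: sum_distrib_left)
    also have "\<dots> \<le> D w - 2 * e * ((\<Sum>i\<in>I. r i * c i) - (\<Sum>i\<in>I. r i * E w i)) + e\<^sup>2 * C"
    proof (intro add_mono diff_left_mono mult_left_mono diff_right_mono z(2))
      have "(\<Sum>i\<in>I. (V z i - E w i)\<^sup>2) \<le> (\<Sum>i\<in>I. (2 * B)\<^sup>2)"
      proof (rule sum_mono)
        fix i assume "i \<in> I"
        then have "\<bar>V z i - E w i\<bar> \<le> 2 * B" using VB[OF z(1)] EB[OF w] by fastforce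
        then show "(V z i - E w i)\<^sup>2 \<le> (2 * B)\<^sup>2" by (metis abs_ge_zero power2_abs power_mono)
      qed
      then show "(\<Sum>i\<in>I. (V z i - E w i)\<^sup>2) \<le> C" by (simp add: C_def)
    qed (use e in auto)
    also have "(\<Sum>i\<in>I. r i * c i) - (\<Sum>i\<in>I. r i * E w i) = D w"
      by (simp add: D_def r_def power2_eq_square right_diff_distrib flip: sum_subtractf)
    finally show ?thesis by (simp add: algebra_simps)
  qed
  have C1: "1 \<le> C" by (simp add: C_def)
  \<comment> \<open>With \<open>e * C \<le> \<epsilon>\<close>, the inequality
    \<open>2 * e * \<delta> \<le> e\<^sup>2 * C\<close> yields
    \<open>2 * \<delta> \<le> \<epsilon>\<close>, against
    \<open>\<epsilon> \<le> \<delta>\<close>.\<close>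
  define e where "e = min (1 / 2) (\<epsilon> / C)"
  have e: "0 < e" "e \<le> 1 / 2" "e * C \<le> \<epsilon>" using eps C1 by (auto simp: e_def min_def field_simps)
  \<comment> \<open>Near-minimisers, up to \<open>h\<close>, take the place of attainment of the
    infimum.\<close>
  have "\<delta> \<le> (1 - 2 * e) * \<delta> + e\<^sup>2 * C"
  proof (rule field_le_epsilon)
    fix h :: real assume h: "0 < h"
    have "\<exists>x\<in>D ` W. x < \<delta> + h"
      unfolding \<delta>_def using h W_ne bdd by (intro cInf_lessD) auto
    then obtain w where w: "w \<in> W" "D w < \<delta> + h" by auto
    have "\<delta> \<le> (1 - 2 * e) * D w + e\<^sup>2 * C" using step[OF w(1)] e by simp
    also have "\<dots> \<le> (1 - 2 * e) * (\<delta> + h) + e\<^sup>2 * C"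
      using w(2) e by (intro add_mono mult_left_mono) auto
    also have "\<dots> \<le> (1 - 2 * e) * \<delta> + e\<^sup>2 * C + h"
      using e h by (simp add: algebra_simps)
    finally show "\<delta> \<le> (1 - 2 * e) * \<delta> + e\<^sup>2 * C + h" .
  qed
  then have "2 * e * \<delta> \<le> e * (e * C)" by (simp add: algebra_simps power2_eq_square)
  also have "\<dots> \<le> e * \<epsilon>" using e by (intro mult_left_mono) auto
  finally have "2 * \<delta> \<le> \<epsilon>" using e by simp
  then show False using \<delta>_ge eps by simp
qed

lemma pmf_of_weights:
  assumes "finite Z" "\<And>z. 0 \<le> w z" "sum w Z = (1 :: real)"
  obtains p where "set_pmf p \<subseteq> Z" "\<And>F. measure_pmf.expectation p F = (\<Sum>z\<in>Z. w z * F z :: real)"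
proof -
  \<comment> \<open>The weights may be positive outside \<open>Z\<close>, where they must not count
    as mass.\<close>
  define v where "v z = (if z \<in> Z then w z else 0)" for z
  have nn: "(\<integral>\<^sup>+z. ennreal (v z) \<partial>count_space UNIV) = 1"
  proof -
    have "(\<integral>\<^sup>+z. ennreal (v z) \<partial>count_space UNIV) = (\<Sum>z\<in>Z. ennreal (v z))"
      by (rule nn_integral_count_space') (use assms in \<open>auto simp: v_def\<close>)
    also have "\<dots> = ennreal (\<Sum>z\<in>Z. v z)" by (rule sum_ennreal) (use assms in \<open>auto simp: v_def\<close>)
    also have "(\<Sum>z\<in>Z. v z) = 1" using assms by (simp add: v_def)
    finally show ?thesis by simp
  qed
  have v0: "0 \<le> v z" for z using assms by (simp add: v_def)
  have pmf: "pmf (embed_pmf v) z = v z" for z by (rule pmf_embed_pmf[OF v0 nn])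
  have sub: "set_pmf (embed_pmf v) \<subseteq> Z" by (auto simp: set_pmf_eq pmf v_def)
  have "measure_pmf.expectation (embed_pmf v) F = (\<Sum>z\<in>Z. w z * F z)" for F
    by (subst integral_measure_pmf_real[OF assms(1)]) (use sub in \<open>auto simp: pmf v_def mult.commute\<close>)
  then show ?thesis using that sub by blast
qed

section \<open>The dual norm and a maximiser\<close>

locale young_loop = young_setting +
  fixes c :: real
  assumes gab: "g a = g b" and c: "c \<in> {a..b}"
begin

lemma young_const_zero: "J (\<lambda>_. k) = 0"
  by (rule young_integral_eq[OF ab]) (rule has_young_integral_const, rule gab)

lemma young_shift: "hol A f \<Longrightarrow> J (\<lambda>x. f x - k) = J f"
  using young_add[of A f 0 "\<lambda>_. - k", OF _ hol_const] young_const_zero by simp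

text \<open>The one-cell sum is \<open>f a * (g b - g a) = 0\<close>, so its error bound is a bound
  for \<open>J\<close> itself.\<close>

lemma young_bounded:
  assumes "hol A f"
  shows "\<bar>J f\<bar> \<le> A * grid_error 1"
proof -
  have "grid_sum 1 f = 0" using gab by (simp add: riemann_sum_def grid_def)
  then show ?thesis using grid_sum_error[OF assms, of 1] by simp
qed

lemma maximiser_exists: "\<exists>f. hol 1 f \<and> f c = 0 \<and> (\<forall>h. hol 1 h \<longrightarrow> J h \<le> J f)"
proof -
  define X where "X = J ` {f. hol 1 f}"
  have X_ne: "X \<noteq> {}" using hol_mono[OF hol_const, of 1 0] by (auto simp: X_def)
  have bdd: "bdd_above X"
    unfolding X_def by (intro bdd_aboveI[of _ "grid_error 1"]) (use young_bounded[of 1] in fastforce)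
  have "\<exists>f. hol 1 f \<and> Sup X - 1 / real (Suc n) < J f" for n
  proof -
    have "\<exists>x\<in>X. Sup X - 1 / real (Suc n) < x" by (rule less_cSupD[OF X_ne]) simp
    then show ?thesis by (auto simp: X_def)
  qed
  then obtain f where f: "\<And>n. hol 1 (f n)" "\<And>n. Sup X - 1 / real (Suc n) < J (f n)" by metis
  \<comment> \<open>Subtracting the value at \<open>c\<close> keeps \<open>J\<close>, makes the
    sequence uniformly bounded, and will make the Hoelder norm of the limit equal to its
    seminorm.\<close>
  define F where "F n x = f n x - f n c" for n x
  have F: "hol 1 (F n)" for n using f(1)[of n] by (simp add: F_def holder_bound_def)
  have JF: "J (F n) = J (f n)" for n unfolding F_def by (rule young_shift[OF f(1)])
  have Fd: "\<bar>F n x - F n y\<bar> \<le> \<bar>x - y\<bar> powr \<alpha>" if "x \<in> {a..b}" "y \<in> {a..b}" for n x y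
    using holder_boundD(1)[OF F that(2,1)] by simp
  obtain h k where k: "strict_mono (k :: nat \<Rightarrow> nat)"
    and unif: "\<And>e. 0 < e \<Longrightarrow> \<exists>N. \<forall>n x. n \<ge> N \<and> x \<in> {a..b} \<longrightarrow> norm (F (k n) x - h x) < e"
  proof (rule Arzela_Ascoli[of "{a..b}" F "(b - a) powr \<alpha>"])
    show "norm (F n x) \<le> (b - a) powr \<alpha>" if x: "x \<in> {a..b}" for n x
    proof -
      have "\<bar>F n x - F n c\<bar> \<le> \<bar>x - c\<bar> powr \<alpha>" by (rule Fd[OF x c])
      also have "\<dots> \<le> (b - a) powr \<alpha>" using x c \<alpha>_pos by (intro powr_mono2) auto
      finally show ?thesis by (simp add: F_def)
    qed
    show "\<exists>d>0. \<forall>n y. y \<in> {a..b} \<and> norm (x - y) < d \<longrightarrow> norm (F n x - F n y) < e"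
      if x: "x \<in> {a..b}" and e: "0 < e" for x e
    proof (intro exI[of _ "e powr (1 / \<alpha>)"] conjI allI impI)
      fix n y assume y: "y \<in> {a..b} \<and> norm (x - y) < e powr (1 / \<alpha>)"
      have "\<bar>F n x - F n y\<bar> \<le> \<bar>x - y\<bar> powr \<alpha>" using x y by (intro Fd) auto
      also have "\<dots> < (e powr (1 / \<alpha>)) powr \<alpha>" using y \<alpha>_pos by (intro powr_less_mono2) auto
      also have "\<dots> = e" using e \<alpha>_pos by (simp add: powr_powr)
      finally show "norm (F n x - F n y) < e" by simp
    qed (use e in simp)
  qed auto
  have lim: "(\<lambda>n. F (k n) x) \<longlonglongrightarrow> h x" if "x \<in> {a..b}" for x
  proof (rule LIMSEQ_I)
    fix e :: real assume "0 < e"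
    then show "\<exists>no. \<forall>n\<ge>no. norm (F (k n) x - h x) < e" using unif[of e] that by blast
  qed
  have h: "hol 1 h"
    unfolding holder_bound_def
  proof (intro conjI ballI)
    fix s t assume st: "s \<in> {a..b}" "t \<in> {a..b}"
    have "(\<lambda>n. \<bar>F (k n) t - F (k n) s\<bar>) \<longlonglongrightarrow> \<bar>h t - h s\<bar>"
      by (intro tendsto_intros lim st)
    then show "\<bar>h t - h s\<bar> \<le> 1 * \<bar>t - s\<bar> powr \<alpha>"
      by (rule LIMSEQ_le_const2) (use Fd st in auto)
  qed simp
  have hc: "h c = 0"
    using LIMSEQ_unique[OF lim[OF c]] by (simp add: F_def)
  have "(\<lambda>n. J (F (k n))) \<longlonglongrightarrow> J h"
    by (rule young_pointwise_continuous[OF F h lim])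
  moreover have "(\<lambda>n. Sup X - 1 / real (Suc n)) \<longlonglongrightarrow> Sup X - 0"
    by (intro tendsto_intros LIMSEQ_Suc[OF lim_1_over_n])
  moreover have "Sup X - 1 / real (Suc n) \<le> J (F (k n))" for n
  proof -
    have "1 / real (Suc (k n)) \<le> 1 / real (Suc n)"
      using seq_suble[OF k, of n] by (intro divide_left_mono) auto
    then show ?thesis using f(2)[of "k n"] JF[of "k n"] by linarith
  qed
  ultimately have "Sup X \<le> J h" by (auto intro: LIMSEQ_le)
  moreover have "J f' \<le> Sup X" if "hol 1 f'" for f'
    using that by (intro cSup_upper[OF _ bdd]) (auto simp: X_def)
  ultimately show ?thesis using h hc by (meson order_trans)
qed

definition maximiser :: "real \<Rightarrow> real" where
  "maximiser = (SOME f. hol 1 f \<and> f c = 0 \<and> (\<forall>h. hol 1 h \<longrightarrow> J h \<le> J f))"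

abbreviation "dual_norm \<equiv> J maximiser"

lemma maximiser: "hol 1 maximiser" "maximiser c = 0" "hol 1 h \<Longrightarrow> J h \<le> dual_norm"
  using someI_ex[OF maximiser_exists] unfolding maximiser_def by blast+

lemma young_le_dual_norm:
  assumes f: "hol A f"
  shows "J f \<le> A * dual_norm"
proof (cases "A = 0")
  case True
  then show ?thesis using young_bounded[OF f] by simp
next
  case False
  then have A: "0 < A" using holder_boundD(2)[OF f] by simp
  then have "hol 1 (\<lambda>x. (1 / A) * f x)" using hol_scale[OF f, of "1 / A"] by simp
  then have "J (\<lambda>x. (1 / A) * f x) \<le> dual_norm" by (rule maximiser(3))
  then have "(1 / A) * J f \<le> dual_norm" unfolding young_scale[OF f] .
  then show ?thesis using A by (simp add: field_simps)
qed

lemma dual_norm_nonneg: "0 \<le> dual_norm"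
  using maximiser(3)[OF hol_mono[OF hol_const], of 0] young_const_zero[of 0] by simp

end

subsection \<open>Optimal couplings for exponents below one\<close>

lemma holder_seminorm_le:
  assumes "holder_bound A \<alpha> I f"
  shows "holder_seminorm \<alpha> I f \<le> ennreal A"
  unfolding holder_seminorm_def
proof (rule SUP_least, clarify)
  fix s t assume st: "s \<in> I" "t \<in> I" "s \<noteq> t"
  have "\<bar>f t - f s\<bar> \<le> A * \<bar>t - s\<bar> powr \<alpha>" by (rule holder_boundD(1)[OF assms st(1,2)])
  then show "ennreal (\<bar>f t - f s\<bar> / \<bar>t - s\<bar> powr \<alpha>) \<le> ennreal A"
    using st(3) by (intro ennreal_leI) (simp add: divide_le_eq)
qed

lemma holder_seminorm_bound:
  assumes "holder_seminorm \<alpha> I f \<le> ennreal A" "0 \<le> A"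
  shows "holder_bound A \<alpha> I f"
  unfolding holder_bound_def
proof (intro conjI ballI assms(2))
  fix s t assume st: "s \<in> I" "t \<in> I"
  show "\<bar>f t - f s\<bar> \<le> A * \<bar>t - s\<bar> powr \<alpha>"
  proof (cases "s = t")
    case False
    have "ennreal (\<bar>f t - f s\<bar> / \<bar>t - s\<bar> powr \<alpha>) \<le> holder_seminorm \<alpha> I f"
      unfolding holder_seminorm_def by (rule SUP_upper2[of "(s, t)"]) (use st False in auto)
    then have "ennreal (\<bar>f t - f s\<bar> / \<bar>t - s\<bar> powr \<alpha>) \<le> ennreal A"
      using assms(1) by (rule order_trans)
    then show ?thesis using assms(2) False by (simp add: divide_le_eq)
  qed simp
qed

lemma holder_space_bound:
  assumes "f \<in> holder_space \<alpha> I"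
  shows "\<exists>A. holder_bound A \<alpha> I f"
proof
  show "holder_bound (enn2real (holder_seminorm \<alpha> I f)) \<alpha> I f"
    using assms by (intro holder_seminorm_bound) (auto simp: holder_space_def)
qed

lemma holder_bound_continuous:
  assumes "holder_bound A p {a..b} f" "0 < p"
  shows "continuous_on {a..b} f"
  unfolding continuous_on_def
proof
  fix x assume x: "x \<in> {a..b}"
  have "((\<lambda>y. A * \<bar>y - x\<bar> powr p) \<longlongrightarrow> A * \<bar>x - x\<bar> powr p) (at x within {a..b})"
    using assms(2) by (intro tendsto_intros tendsto_powr') auto
  then have lim: "((\<lambda>y. A * \<bar>y - x\<bar> powr p) \<longlongrightarrow> 0) (at x within {a..b})"
    using assms(2) by simp
  have "((\<lambda>y. f y - f x) \<longlongrightarrow> 0) (at x within {a..b})"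
    by (rule Lim_null_comparison[OF _ lim])
       (use holder_boundD(1)[OF assms(1) x] in \<open>auto simp: eventually_at_filter\<close>)
  then show "(f \<longlongrightarrow> f x) (at x within {a..b})" by (simp add: LIM_zero_iff)
qed

text \<open>\<open>0 powr y = 0\<close> makes this zero on the diagonal, which is the continuous
  value there for Lipschitz \<open>f\<close> and exponents in \<open>(0,1)\<close>.\<close>

definition difference_quotient :: "real \<Rightarrow> (real \<Rightarrow> real) \<Rightarrow> real \<times> real \<Rightarrow> real" where
  "difference_quotient \<alpha> f z = (f (snd z) - f (fst z)) * \<bar>snd z - fst z\<bar> powr (- \<alpha>)"

lemma difference_quotient_bound:
  assumes "holder_bound A \<alpha> I f" "z \<in> I \<times> I"
  shows "\<bar>difference_quotient \<alpha> f z\<bar> \<le> A"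
proof (cases "fst z = snd z")
  case True
  then show ?thesis using holder_boundD(2)[OF assms(1)] by (simp add: difference_quotient_def)
next
  case False
  have "\<bar>difference_quotient \<alpha> f z\<bar> \<le> (A * \<bar>snd z - fst z\<bar> powr \<alpha>) * \<bar>snd z - fst z\<bar> powr (- \<alpha>)"
    unfolding difference_quotient_def abs_mult
    using assms(2) by (intro mult_mono holder_boundD(1)[OF assms(1)]) (auto simp: mem_Times_iff holder_boundD(2)[OF assms(1)])
  also have "\<dots> = A" using False by (simp add: mult.assoc flip: powr_add)
  finally show ?thesis .
qed

lemma difference_quotient_continuous:
  assumes f: "\<And>s t. \<bar>f t - f s\<bar> \<le> L * \<bar>t - s\<bar>" and p: "0 < p" "p < 1"
  shows "continuous_on S (difference_quotient p f)"
proof (rule continuous_on_subset[OF _ subset_UNIV], unfold continuous_on_eq_continuous_within, rule ballI)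
  fix z :: "real \<times> real"
  have "holder_bound \<bar>L\<bar> 1 {u..v} f" for u v
  proof -
    have "\<bar>f t - f s\<bar> \<le> \<bar>L\<bar> * \<bar>t - s\<bar>" for s t
      by (rule order_trans[OF f]) (intro mult_right_mono, auto)
    then show ?thesis by (simp add: holder_bound_def)
  qed
  then have fc: "continuous_on {u..v} f" for u v by (rule holder_bound_continuous) simp
  have f_cont: "isCont f x" for x
    using continuous_on_interior[OF fc[of "x - 1" "x + 1"], of x] by simp
  show "isCont (difference_quotient p f) z"
  proof (cases "fst z = snd z")
    case False
    then show ?thesis
      unfolding difference_quotient_def
      by (intro continuous_intros isCont_o2[OF _ f_cont]) auto
  next
    case True
    have "((\<lambda>w. L * \<bar>snd w - fst w\<bar> powr (1 - p)) \<longlongrightarrow> L * \<bar>snd z - fst z\<bar> powr (1 - p)) (at z)"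
      using p by (intro tendsto_intros tendsto_powr') auto
    then have lim: "((\<lambda>w. L * \<bar>snd w - fst w\<bar> powr (1 - p)) \<longlongrightarrow> 0) (at z)"
      using True p by simp
    have "\<bar>difference_quotient p f w\<bar> \<le> L * \<bar>snd w - fst w\<bar> powr (1 - p)" for w
    proof (cases "fst w = snd w")
      case False
      have "\<bar>difference_quotient p f w\<bar> \<le> (L * \<bar>snd w - fst w\<bar>) * \<bar>snd w - fst w\<bar> powr (- p)"
        unfolding difference_quotient_def abs_mult by (auto intro!: mult_right_mono f)
      then show ?thesis using False by (simp add: powr_diff powr_minus_divide)
    qed (use p in \<open>simp add: difference_quotient_def\<close>)
    then have "((\<lambda>w. difference_quotient p f w) \<longlongrightarrow> 0) (at z)"
      by (intro Lim_null_comparison[OF _ lim]) (auto intro: always_eventually)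
    moreover have "difference_quotient p f z = 0" using True by (simp add: difference_quotient_def)
    ultimately show ?thesis by (simp add: isCont_def)
  qed
qed

section \<open>From representations on grids to a coupling\<close>

context young_loop
begin

text \<open>The Riemann sum is a linear functional of the \<open>n + 1\<close> grid values, to be
  approximated by convex combinations of quotient functionals scaled by \<open>M\<close>. Any grid
  values extend to a function whose Hoelder constant is their largest quotient, and this yields the
  separation hypothesis of \<open>convex_hull_approximation\<close>. \<open>M\<close> exceeds
  \<open>dual_norm\<close> by the grid error because \<open>dual_norm\<close> controls
  \<open>J\<close>, not the sum.\<close>

lemma discrete_representation:
  assumes n: "0 < n" and eps: "0 < \<epsilon>"
  shows "\<exists>p. set_pmf p \<subseteq> {a..b} \<times> {a..b} \<and>
    (\<forall>f B. (\<forall>x\<in>{a..b}. \<bar>f x\<bar> \<le> B) \<longrightarrow>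
      \<bar>grid_sum n f - (dual_norm + grid_error n) * measure_pmf.expectation p (difference_quotient \<alpha> f)\<bar>
        \<le> B * \<epsilon>)"
proof -
  define M where "M = dual_norm + grid_error n"
  define x where "x = grid n"
  define Z where "Z = {(j, k). j \<le> n \<and> k \<le> n \<and> j \<noteq> k}"
  define d where "d z = \<bar>x (snd z) - x (fst z)\<bar>" for z :: "nat \<times> nat"
  define V where "V z i = M * (d z powr (- \<alpha>) * (of_bool (i = snd z) - of_bool (i = fst z)))" for z i
  \<comment> \<open>The coefficient of the \<open>i\<close>-th grid value; the last is zero because
    \<open>f\<close> is evaluated at left end points.\<close>
  define cc where "cc i = (if i < n then g (x (Suc i)) - g (x i) else 0)" for i
  have Z_fin: "finite Z"
    by (rule finite_subset[of _ "{..n} \<times> {..n}"]) (auto simp: Z_def)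
  have Z01: "(0, 1) \<in> Z" "(1, 0) \<in> Z" using n by (auto simp: Z_def)
  have x_in: "x i \<in> {a..b}" if "i \<le> n" for i using grid_in[OF n that] by (simp add: x_def)
  have x_inj: "x i = x j \<longleftrightarrow> i = j" for i j using n ab by (simp add: x_def grid_def)
  have d_pos: "0 < d z" if "z \<in> Z" for z using that x_inj by (auto simp: d_def Z_def)
  have sum_cc: "(\<Sum>i\<in>{..n}. f (x i) * cc i) = grid_sum n f" for f
    by (simp add: cc_def riemann_sum_def x_def flip: lessThan_Suc_atMost)
  have sum_V: "(\<Sum>i\<in>{..n}. l i * V z i) = M * ((l (snd z) - l (fst z)) * d z powr (- \<alpha>))"
    if "z \<in> Z" for l z
  proof -
    have delta: "(\<Sum>i\<in>{..n}. l i * of_bool (i = m)) = l m" if "m \<le> n" for m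
    proof -
      have "(\<Sum>i\<in>{..n}. l i * of_bool (i = m)) = (\<Sum>i\<in>{..n}. if i = m then l i else 0)"
        by (intro sum.cong) auto
      then show ?thesis using that by simp
    qed
    have "(\<Sum>i\<in>{..n}. l i * V z i) =
      (\<Sum>i\<in>{..n}. M * d z powr (- \<alpha>) * (l i * of_bool (i = snd z) - l i * of_bool (i = fst z)))"
      unfolding V_def by (intro sum.cong refl) (simp add: algebra_simps)
    also have "\<dots> = M * d z powr (- \<alpha>) * (l (snd z) - l (fst z))"
      using that delta by (auto simp: Z_def sum_subtractf simp flip: sum_distrib_left)
    finally show ?thesis by simp
  qed
  have sep: "\<exists>z\<in>Z. (\<Sum>i\<in>{..n}. l i * cc i) \<le> (\<Sum>i\<in>{..n}. l i * V z i)" for l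
  proof -
    define R where "R z = (l (snd z) - l (fst z)) * d z powr (- \<alpha>)" for z
    define L where "L = Max (R ` Z)"
    have "L \<in> R ` Z" unfolding L_def using Z_fin Z01 by (intro Max_in) auto
    then obtain z where z: "z \<in> Z" "R z = L" by auto
    have R_le: "R z \<le> L" if "z \<in> Z" for z unfolding L_def using that Z_fin by simp
    \<comment> \<open>The quotient is odd under exchange of the points, so its maximum is
      nonnegative.\<close>
    have "R (1, 0) = - R (0, 1)" by (simp add: R_def d_def abs_minus_commute algebra_simps)
    then have L0: "0 \<le> L" using R_le[OF Z01(1)] R_le[OF Z01(2)] by linarith
    have l_le: "l k - l j \<le> L * \<bar>x k - x j\<bar> powr \<alpha>" if "j \<le> n" "k \<le> n" for j k
    proof (cases "j = k")
      case False
      then have jk: "(j, k) \<in> Z" using that by (simp add: Z_def)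
      have "R (j, k) * d (j, k) powr \<alpha> \<le> L * d (j, k) powr \<alpha>"
        by (intro mult_right_mono R_le jk) auto
      moreover have "R (j, k) * d (j, k) powr \<alpha> = l k - l j"
        using d_pos[OF jk] by (simp add: R_def mult.assoc flip: powr_add)
      ultimately show ?thesis by (simp add: d_def)
    qed simp
    define l' where "l' = (\<lambda>y. l (the_inv_into {..n} x y))"
    have inj: "inj_on x {..n}" using x_inj by (auto simp: inj_on_def)
    have l': "l' (x i) = l i" if "i \<le> n" for i
      using the_inv_into_f_f[OF inj, of i] that by (simp add: l'_def)
    have "l' t - l' s \<le> L * \<bar>t - s\<bar> powr \<alpha>" if "s \<in> x ` {..n}" "t \<in> x ` {..n}" for s t
      using that l_le l' by auto
    then obtain f where f: "\<forall>y\<in>x ` {..n}. f y = l' y" "\<forall>I. holder_bound L \<alpha> I f"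
      using mcshane_extension[of "x ` {..n}" \<alpha> L l'] \<alpha>_pos \<alpha>(2) L0 by blast
    have f_hol: "hol L f" using f(2) by blast
    have "(\<Sum>i\<in>{..n}. l i * cc i) = (\<Sum>i\<in>{..n}. f (x i) * cc i)"
      using f(1) l' by (intro sum.cong) auto
    also have "\<dots> = grid_sum n f" by (rule sum_cc)
    also have "\<dots> \<le> L * dual_norm + L * grid_error n"
      using grid_sum_error[OF f_hol n] young_le_dual_norm[OF f_hol] by linarith
    also have "\<dots> = M * R z" by (simp add: M_def z(2) algebra_simps)
    also have "\<dots> = (\<Sum>i\<in>{..n}. l i * V z i)" by (simp add: sum_V[OF z(1)] R_def)
    finally show ?thesis using z(1) by blast
  qed
  \<comment> \<open>Each of the \<open>n + 1\<close> coordinates may be off by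
    \<open>\<eta>\<close>, which adds up to \<open>B * \<epsilon>\<close>.\<close>
  define \<eta> where "\<eta> = \<epsilon> / real (Suc n)"
  have \<eta>: "0 < \<eta>" "real (Suc n) * \<eta> = \<epsilon>" using eps by (auto simp: \<eta>_def)
  obtain w where w: "\<And>z. 0 \<le> w z" "sum w Z = 1"
    and w_close: "(\<Sum>i\<in>{..n}. (cc i - (\<Sum>z\<in>Z. w z * V z i))\<^sup>2) < \<eta>\<^sup>2"
    using convex_hull_approximation[OF finite_atMost Z_fin sep, of "\<eta>\<^sup>2"] \<eta>(1) by auto
  have close: "\<bar>cc i - (\<Sum>z\<in>Z. w z * V z i)\<bar> \<le> \<eta>" if "i \<le> n" for i
  proof -
    have "(cc i - (\<Sum>z\<in>Z. w z * V z i))\<^sup>2 \<le> (\<Sum>i\<in>{..n}. (cc i - (\<Sum>z\<in>Z. w z * V z i))\<^sup>2)"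
      using that by (intro member_le_sum[where f="\<lambda>i. (cc i - (\<Sum>z\<in>Z. w z * V z i))\<^sup>2"]) auto
    then have "(cc i - (\<Sum>z\<in>Z. w z * V z i))\<^sup>2 \<le> \<eta>\<^sup>2" using w_close by linarith
    then show ?thesis using \<eta>(1) by (simp add: abs_le_square_iff[symmetric])
  qed
  obtain p0 where p0: "set_pmf p0 \<subseteq> Z"
    and p0_int: "\<And>F. measure_pmf.expectation p0 F = (\<Sum>z\<in>Z. w z * F z :: real)"
    using pmf_of_weights[OF Z_fin w] by blast
  define p where "p = map_pmf (\<lambda>z. (x (fst z), x (snd z))) p0"
  have "set_pmf p \<subseteq> {a..b} \<times> {a..b}"
    using p0 x_in by (fastforce simp: p_def Z_def)
  moreover have "\<bar>grid_sum n f - M * measure_pmf.expectation p (difference_quotient \<alpha> f)\<bar> \<le> B * \<epsilon>"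
    if B: "\<forall>y\<in>{a..b}. \<bar>f y\<bar> \<le> B" for f B
  proof -
    have "M * measure_pmf.expectation p (difference_quotient \<alpha> f)
        = (\<Sum>z\<in>Z. w z * (M * ((f (x (snd z)) - f (x (fst z))) * d z powr (- \<alpha>))))"
      by (simp add: p_def p0_int difference_quotient_def d_def sum_distrib_left algebra_simps)
    also have "\<dots> = (\<Sum>z\<in>Z. w z * (\<Sum>i\<in>{..n}. f (x i) * V z i))"
      by (intro sum.cong refl) (simp add: sum_V)
    also have "\<dots> = (\<Sum>i\<in>{..n}. f (x i) * (\<Sum>z\<in>Z. w z * V z i))"
      unfolding sum_distrib_left by (subst sum.swap) (intro sum.cong refl, simp)
    finally have "grid_sum n f - M * measure_pmf.expectation p (difference_quotient \<alpha> f)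
        = (\<Sum>i\<in>{..n}. f (x i) * (cc i - (\<Sum>z\<in>Z. w z * V z i)))"
      by (simp add: right_diff_distrib sum_subtractf sum_cc)
    also have "\<bar>\<dots>\<bar> \<le> (\<Sum>i\<in>{..n}. B * \<eta>)"
    proof (rule order_trans[OF sum_abs], rule sum_mono)
      fix i assume "i \<in> {..n}"
      then have i: "i \<le> n" by simp
      then have "\<bar>f (x i)\<bar> \<le> B" using B x_in by blast
      then show "\<bar>f (x i) * (cc i - (\<Sum>z\<in>Z. w z * V z i))\<bar> \<le> B * \<eta>"
        unfolding abs_mult using close[OF i] by (intro mult_mono) auto
    qed
    also have "\<dots> = B * (real (Suc n) * \<eta>)" by simp
    also have "\<dots> = B * \<epsilon>" by (simp only: \<eta>(2))
    finally show ?thesis .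
  qed
  ultimately show ?thesis unfolding M_def by blast
qed

text \<open>On the grid with \<open>Suc n\<close> cells the tolerance is \<open>1 / Suc n\<close>,
  so tolerance and grid error vanish together. \<open>L\<close> provides continuity of the quotient;
  the formula is the same for every \<open>L\<close>, which may thus grow along an approximating
  sequence while \<open>A\<close> stays fixed.\<close>

lemma lipschitz_representation:
  assumes "\<alpha> < 1"
  obtains N where "prob_space N" "sets N = sets (restrict_space borel ({a..b} \<times> {a..b}))"
    "\<And>f L A. (\<And>s t. \<bar>f t - f s\<bar> \<le> L * \<bar>t - s\<bar>) \<Longrightarrow> hol A f \<Longrightarrow>
       J f = dual_norm * integral\<^sup>L N (difference_quotient \<alpha> f)"
proof -
  have "\<exists>p. set_pmf p \<subseteq> {a..b} \<times> {a..b} \<and>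
    (\<forall>f B. (\<forall>x\<in>{a..b}. \<bar>f x\<bar> \<le> B) \<longrightarrow>
      \<bar>grid_sum (Suc n) f - (dual_norm + grid_error (Suc n)) * measure_pmf.expectation p (difference_quotient \<alpha> f)\<bar>
        \<le> B * (1 / real (Suc n)))" for n
    by (rule discrete_representation) auto
  then obtain p where p: "\<And>n. set_pmf (p n) \<subseteq> {a..b} \<times> {a..b}"
    and rep: "\<And>n f B. (\<forall>x\<in>{a..b}. \<bar>f x\<bar> \<le> B) \<Longrightarrow>
      \<bar>grid_sum (Suc n) f - (dual_norm + grid_error (Suc n)) * measure_pmf.expectation (p n) (difference_quotient \<alpha> f)\<bar>
        \<le> B * (1 / real (Suc n))"
    by metis
  obtain r N where r: "strict_mono r" and N: "prob_space N" "sets N = sets (restrict_space borel ({a..b} \<times> {a..b}))"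
    and lim: "\<And>F :: real \<times> real \<Rightarrow> real. continuous_on ({a..b} \<times> {a..b}) F \<Longrightarrow>
       (\<lambda>n. measure_pmf.expectation (p (r n)) F) \<longlonglongrightarrow> integral\<^sup>L N F"
    using pmf_square_compact[where p=p, OF ab p] by blast
  have "J f = dual_norm * integral\<^sup>L N (difference_quotient \<alpha> f)"
    if lip: "\<And>s t. \<bar>f t - f s\<bar> \<le> L * \<bar>t - s\<bar>" and f: "hol A f" for f L A
  proof -
    obtain B where B: "\<forall>x\<in>{a..b}. \<bar>f x\<bar> \<le> B"
      using compact_imp_bounded[OF compact_continuous_image[OF holder_bound_continuous[OF f \<alpha>_pos] compact_Icc]]
      by (auto simp: bounded_iff)
    have sub: "(\<lambda>n. h (Suc (r n))) \<longlonglongrightarrow> l" if "h \<longlonglongrightarrow> l" for h :: "nat \<Rightarrow> real" and l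
      using LIMSEQ_subseq_LIMSEQ[OF LIMSEQ_Suc[OF that] r] by (simp add: o_def)
    define E where "E n = measure_pmf.expectation (p (r n)) (difference_quotient \<alpha> f)" for n
    have "(\<lambda>n. grid_sum (Suc (r n)) f - (dual_norm + grid_error (Suc (r n))) * E n)
        \<longlonglongrightarrow> J f - (dual_norm + 0) * integral\<^sup>L N (difference_quotient \<alpha> f)"
      unfolding E_def
      by (intro tendsto_intros lim sub[of "\<lambda>n. grid_sum n f"] sub[of grid_error]
          grid_sum_tendsto[OF f] grid_error_tendsto difference_quotient_continuous[OF lip \<alpha>_pos assms])
    moreover have "(\<lambda>n. grid_sum (Suc (r n)) f - (dual_norm + grid_error (Suc (r n))) * E n) \<longlonglongrightarrow> 0"
    proof (rule Lim_null_comparison)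
      show "\<forall>\<^sub>F n in sequentially.
          norm (grid_sum (Suc (r n)) f - (dual_norm + grid_error (Suc (r n))) * E n) \<le> B * (1 / real (Suc (r n)))"
        using rep[OF B] unfolding E_def by (intro always_eventually) auto
      have "(\<lambda>n. B * (1 / real (Suc (r n)))) \<longlonglongrightarrow> B * 0"
        by (intro tendsto_mult_left sub[of "\<lambda>n. 1 / real n"] lim_1_over_n)
      then show "(\<lambda>n. B * (1 / real (Suc (r n)))) \<longlonglongrightarrow> 0" by simp
    qed
    ultimately show ?thesis using LIMSEQ_unique by fastforce
  qed
  then show ?thesis using that N by blast
qed

lemma difference_quotient_measurable:
  assumes "hol A f" "sets N = sets (restrict_space borel ({a..b} \<times> {a..b}))"
  shows "difference_quotient \<alpha> f \<in> borel_measurable N"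
    "(\<lambda>z. f (snd z) - f (fst z)) \<in> borel_measurable N"
    "(\<lambda>z. \<bar>snd z - fst z\<bar> powr p) \<in> borel_measurable N"
proof -
  note fc = holder_bound_continuous[OF assms(1) \<alpha>_pos]
  have "continuous_on ({a..b} \<times> {a..b}) (\<lambda>z. f (snd z) - f (fst z))"
    by (intro continuous_intros continuous_on_compose2[OF fc]) auto
  then show 1: "(\<lambda>z. f (snd z) - f (fst z)) \<in> borel_measurable N"
    using borel_measurable_continuous_on_restrict measurable_cong_sets[OF assms(2) refl] by blast
  have "continuous_on ({a..b} \<times> {a..b}) (\<lambda>z. \<bar>snd z - fst z\<bar> :: real)"
    by (intro continuous_intros)
  then have 2: "(\<lambda>z. \<bar>snd z - fst z\<bar>) \<in> borel_measurable N"
    using borel_measurable_continuous_on_restrict measurable_cong_sets[OF assms(2) refl] by blast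
  show 3: "(\<lambda>z. \<bar>snd z - fst z\<bar> powr p) \<in> borel_measurable N" for p
    using 2 by measurable
  show "difference_quotient \<alpha> f \<in> borel_measurable N"
    unfolding difference_quotient_def using 1 3 by measurable
qed

text \<open>The density \<open>dual_norm * \<bar>t - s\<bar> powr (- \<alpha>)\<close> turns
  integrals of quotients against \<open>N\<close> into integrals of differences. It is zero on the
  diagonal, so mass of \<open>N\<close> there is dropped; hence only an inequality for the
  cost.\<close>

lemma coupling_exists_subunit:
  assumes "\<alpha> < 1"
  shows "\<exists>\<pi>\<in>couplings \<alpha> a b g. transport_cost \<alpha> \<pi> \<le> ennreal dual_norm"
proof -
  obtain N where "prob_space N" and N: "sets N = sets (restrict_space borel ({a..b} \<times> {a..b}))"
    and rep: "\<And>f L A. (\<And>s t. \<bar>f t - f s\<bar> \<le> L * \<bar>t - s\<bar>) \<Longrightarrow> hol A f \<Longrightarrow>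
       J f = dual_norm * integral\<^sup>L N (difference_quotient \<alpha> f)"
    using lipschitz_representation[OF assms] by blast
  interpret N: prob_space N by fact
  have space: "space N = {a..b} \<times> {a..b}"
    using sets_eq_imp_space_eq[OF N] by (simp add: space_restrict_space)
  have rep': "J f = dual_norm * integral\<^sup>L N (difference_quotient \<alpha> f)" if f: "hol A f" for f A
  proof -
    obtain h where h: "\<And>k. hol A (h k)" "\<And>k s t. \<bar>h k t - h k s\<bar> \<le> real k * \<bar>t - s\<bar>"
      "\<And>x. x \<in> {a..b} \<Longrightarrow> (\<lambda>k. h k x) \<longlonglongrightarrow> f x"
      using lipschitz_approximation[OF f \<alpha>_pos \<alpha>(2) less_imp_le[OF ab]] by blast
    have "(\<lambda>k. integral\<^sup>L N (difference_quotient \<alpha> (h k))) \<longlonglongrightarrow> integral\<^sup>L N (difference_quotient \<alpha> f)"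
    \<comment> \<open>All quotients of \<open>h k\<close> share the bound \<open>A\<close> and
      converge everywhere, on the diagonal because they are zero there.\<close>
    proof (rule integral_dominated_convergence[where w="\<lambda>_. A"])
      show "difference_quotient \<alpha> f \<in> borel_measurable N" by (rule difference_quotient_measurable[OF f N])
      show "difference_quotient \<alpha> (h k) \<in> borel_measurable N" for k
        by (rule difference_quotient_measurable[OF h(1) N])
      show "AE z in N. norm (difference_quotient \<alpha> (h k) z) \<le> A" for k
        using difference_quotient_bound[OF h(1)] by (intro AE_I2) (auto simp: space)
      show "AE z in N. (\<lambda>k. difference_quotient \<alpha> (h k) z) \<longlonglongrightarrow> difference_quotient \<alpha> f z"
        unfolding difference_quotient_def
        by (intro AE_I2 tendsto_intros h(3)) (auto simp: space)
    qed simp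
    then have "(\<lambda>k. dual_norm * integral\<^sup>L N (difference_quotient \<alpha> (h k)))
        \<longlonglongrightarrow> dual_norm * integral\<^sup>L N (difference_quotient \<alpha> f)"
      by (rule tendsto_mult_left)
    moreover have "(\<lambda>k. J (h k)) \<longlonglongrightarrow> J f"
      by (rule young_pointwise_continuous[OF h(1) f h(3)])
    ultimately show ?thesis
      using rep[OF h(2) h(1)] LIMSEQ_unique by auto
  qed
  define w where "w z = dual_norm * \<bar>snd z - fst z\<bar> powr (- \<alpha>)" for z :: "real \<times> real"
  have w0: "0 \<le> w z" for z using dual_norm_nonneg by (simp add: w_def)
  note [measurable] = difference_quotient_measurable(3)[OF hol_const N]
  have w_meas [measurable]: "w \<in> borel_measurable N" unfolding w_def by measurable
  define \<pi> where "\<pi> = density N (\<lambda>z. ennreal (w z))"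
  have "transport_cost \<alpha> \<pi> = (\<integral>\<^sup>+z. ennreal (w z) * ennreal (\<bar>snd z - fst z\<bar> powr \<alpha>) \<partial>N)"
    unfolding transport_cost_def \<pi>_def case_prod_unfold by (rule nn_integral_density) measurable
  also have "\<dots> \<le> (\<integral>\<^sup>+z. ennreal dual_norm \<partial>N)"
  proof (rule nn_integral_mono)
    fix z :: "real \<times> real"
    have "w z * \<bar>snd z - fst z\<bar> powr \<alpha> \<le> dual_norm"
      using dual_norm_nonneg by (cases "fst z = snd z") (auto simp: w_def mult.assoc simp flip: powr_add)
    then show "ennreal (w z) * ennreal (\<bar>snd z - fst z\<bar> powr \<alpha>) \<le> ennreal dual_norm"
      by (subst ennreal_mult[symmetric]) (auto simp: w0 intro: ennreal_leI)
  qed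
  also have "\<dots> = ennreal dual_norm" by (simp add: N.emeasure_space_1)
  finally have cost: "transport_cost \<alpha> \<pi> \<le> ennreal dual_norm" .
  have "(\<integral>(s, t). f t - f s \<partial>\<pi>) = J f" if f_in: "f \<in> holder_space \<alpha> {a..b}" for f
  proof -
    obtain A where f: "hol A f" using holder_space_bound[OF f_in] by blast
    have "(\<integral>z. f (snd z) - f (fst z) \<partial>\<pi>) = (\<integral>z. w z *\<^sub>R (f (snd z) - f (fst z)) \<partial>N)"
      unfolding \<pi>_def
      by (rule integral_density) (use difference_quotient_measurable[OF f N] w0 in auto)
    also have "\<dots> = (\<integral>z. dual_norm * difference_quotient \<alpha> f z \<partial>N)"
      by (intro Bochner_Integration.integral_cong refl) (simp add: w_def difference_quotient_def)
    also have "\<dots> = J f" using rep'[OF f] by simp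
    finally show ?thesis by (simp add: case_prod_unfold)
  qed
  moreover have "sets \<pi> = sets (restrict_space borel ({a..b} \<times> {a..b}))" using N by (simp add: \<pi>_def)
  ultimately have "\<pi> \<in> couplings \<alpha> a b g"
    using le_less_trans[OF cost ennreal_less_top] by (simp add: couplings_def)
  then show ?thesis using cost by blast
qed

end

subsection \<open>The Lipschitz case\<close>

lemma sum_children:
  fixes h :: "nat \<Rightarrow> real"
  assumes "p \<le> r"
  shows "(\<Sum>j\<in>{2 * p..<2 * r}. h j) = (\<Sum>j\<in>{p..<r}. h (2 * j) + h (2 * j + 1))"
  using assms
proof (induction r rule: dec_induct)
  case (step r)
  have "{2 * p..<2 * Suc r} = insert (2 * r + 1) (insert (2 * r) {2 * p..<2 * r})"
    using step.hyps by auto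
  then show ?case using step by simp
qed simp

text \<open>Summation by parts along a binary tree: as \<open>D\<close> is additive over the two
  children, the parents' terms of each level cancel the sum over the level above. Only the finest
  level remains, since the root has value zero.\<close>

lemma heap_telescope:
  fixes v D :: "nat \<Rightarrow> real"
  assumes v1: "v 1 = 0" and D: "\<And>j. 1 \<le> j \<Longrightarrow> D j = D (2 * j) + D (2 * j + 1)"
  shows "(\<Sum>j\<in>{2..<2 ^ Suc n}. (v j - v (j div 2)) * D j) = (\<Sum>j\<in>{2 ^ n..<2 ^ Suc n}. v j * D j)"
proof (induction n)
  case 0
  have "{1..<2 :: nat} = {1}" by auto
  then show ?case using v1 by simp
next
  case (Suc n)
  have "(1 :: nat) \<le> 2 ^ n" by simp
  have "{2..<2 ^ Suc (Suc n) :: nat} = {2..<2 ^ Suc n} \<union> {2 ^ Suc n..<2 ^ Suc (Suc n)}"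
    using \<open>1 \<le> 2 ^ n\<close> by (intro ivl_disj_un_two(3)[symmetric]) auto
  then have "(\<Sum>j\<in>{2..<2 ^ Suc (Suc n)}. (v j - v (j div 2)) * D j) =
      (\<Sum>j\<in>{2 ^ n..<2 ^ Suc n}. v j * D j) + (\<Sum>j\<in>{2 ^ Suc n..<2 ^ Suc (Suc n)}. (v j - v (j div 2)) * D j)"
    by (simp only: Suc.IH[symmetric]) (rule sum.union_disjoint; auto)
  moreover have "(\<Sum>j\<in>{2 ^ Suc n..<2 ^ Suc (Suc n)}. v (j div 2) * D j) = (\<Sum>j\<in>{2 ^ n..<2 ^ Suc n}. v j * D j)"
  proof -
    have "(\<Sum>j\<in>{2 ^ Suc n..<2 ^ Suc (Suc n)}. v (j div 2) * D j)
        = (\<Sum>j\<in>{2 * 2 ^ n..<2 * 2 ^ Suc n}. v (j div 2) * D j)" by simp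
    also have "\<dots> = (\<Sum>j\<in>{2 ^ n..<2 ^ Suc n}. v (2 * j div 2) * D (2 * j) + v ((2 * j + 1) div 2) * D (2 * j + 1))"
      by (rule sum_children) simp
    also have "\<dots> = (\<Sum>j\<in>{2 ^ n..<2 ^ Suc n}. v j * D j)"
    proof (intro sum.cong refl)
      fix j :: nat assume "j \<in> {2 ^ n..<2 ^ Suc n}"
      then have "1 \<le> j" using \<open>1 \<le> 2 ^ n\<close> by (auto intro: order_trans)
      then show "v (2 * j div 2) * D (2 * j) + v ((2 * j + 1) div 2) * D (2 * j + 1) = v j * D j"
        using D[of j] by (simp add: distrib_left)
    qed
    finally show ?thesis .
  qed
  ultimately show ?case by (simp add: left_diff_distrib sum_subtractf)
qed

text \<open>Below \<open>d powr q\<close> the power is at most \<open>d\<close>; above, its ratio to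
  \<open>x\<close> decreases. The gain is that sums of the linear term telescope when
  \<open>x\<close> is an increment of the control.\<close>

lemma powr_le_affine:
  fixes x d q :: real
  assumes "0 \<le> x" "0 < d" "1 < q"
  shows "x powr (1 / q) \<le> d + d powr (1 - q) * x"
proof (cases "x \<le> d powr q")
  case True
  then have "x powr (1 / q) \<le> (d powr q) powr (1 / q)"
    using assms by (intro powr_mono2) auto
  also have "\<dots> = d" using assms by (simp add: powr_powr)
  finally show ?thesis using assms by (simp add: add_increasing2)
next
  case False
  moreover have "0 < d powr q" using assms by simp
  ultimately have x: "d powr q < x" "0 < x" by linarith+
  have "x powr (1 / q) = x powr (1 / q - 1) * x" using x by (simp add: powr_diff)
  also have "\<dots> \<le> (d powr q) powr (1 / q - 1) * x"
    using x assms by (intro mult_right_mono powr_mono2') auto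
  also have "(d powr q) powr (1 / q - 1) = d powr (1 - q)"
    using assms by (simp add: powr_powr right_diff_distrib)
  finally show ?thesis using assms by simp
qed

section \<open>Summation by parts and the dyadic decomposition of \<open>g - g a\<close>\<close>

context young_loop
begin

text \<open>Both boundary terms vanish as \<open>g a = g b\<close>. The shift moves the samples of
  \<open>g\<close> to right end points, which is why later samples are taken there.\<close>

lemma riemann_sum_by_parts:
  assumes "is_partition a b m t"
  shows "riemann_sum f g m t = - (\<Sum>i<m. (g (t (Suc i)) - g a) * (f (t (Suc i)) - f (t i)))"
proof -
  have "riemann_sum f g m t + (\<Sum>i<m. (g (t (Suc i)) - g a) * (f (t (Suc i)) - f (t i)))
      = (\<Sum>i<m. (g (t (Suc i)) - g a) * f (t (Suc i)) - (g (t i) - g a) * f (t i))"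
    unfolding riemann_sum_def sum.distrib[symmetric] by (intro sum.cong refl) (simp add: algebra_simps)
  also have "\<dots> = 0"
    using assms gab sum_lessThan_telescope[of "\<lambda>i. (g (t i) - g a) * f (t i)" m]
    by (simp add: is_partition_def)
  finally show ?thesis by simp
qed

text \<open>The left side is a Riemann sum for the \<open>L\<^sup>1\<close> norm of
  \<open>g - g a\<close>. By parts, it is the grid sum of a function of Lipschitz constant one whose
  grid increments are the cell length times the opposite sign of \<open>g - g a\<close>.\<close>

lemma grid_deviation_le:
  assumes \<alpha>1: "\<alpha> = 1" and n: "0 < n"
  shows "(\<Sum>i<n. \<bar>g (grid n (Suc i)) - g a\<bar> * ((b - a) / real n)) \<le> dual_norm + grid_error n"
proof -
  define x where "x = grid n"
  define s where "s i = - sgn (g (x (Suc i)) - g a)" for i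
  define l where "l i = (\<Sum>j<i. s j * ((b - a) / real n))" for i
  have h: "0 \<le> (b - a) / real n" using ab by simp
  have l_step: "l (Suc i) - l i = s i * ((b - a) / real n)" for i by (simp add: l_def)
  have x_step: "x (Suc i) - x i = (b - a) / real n" for i by (simp add: x_def grid_step)
  have s1: "\<bar>s i * ((b - a) / real n)\<bar> \<le> (b - a) / real n" for i
    using h by (auto simp: s_def sgn_if abs_mult)
  have up: "\<bar>l k - l j\<bar> \<le> x k - x j" if "j \<le> k" for j k
    using that
  proof (induction k rule: dec_induct)
    case (step k)
    have "\<bar>l (Suc k) - l k\<bar> \<le> x (Suc k) - x k" unfolding l_step x_step by (rule s1)
    then show ?case using step.IH by linarith
  qed simp
  have l_lip: "l k - l j \<le> 1 * \<bar>x k - x j\<bar> powr 1" for j k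
    using up[of j k] up[of k j] by (cases "j \<le> k") auto
  have x_inj: "x i = x j \<longleftrightarrow> i = j" for i j using n ab by (simp add: x_def grid_def)
  define l' where "l' = (\<lambda>y. l (the_inv_into {..n} x y))"
  have l': "l' (x i) = l i" if "i \<le> n" for i
    using the_inv_into_f_f[of x "{..n}" i] that x_inj by (simp add: l'_def inj_on_def)
  have "l' t - l' s \<le> 1 * \<bar>t - s\<bar> powr 1" if "s \<in> x ` {..n}" "t \<in> x ` {..n}" for s t
    using that l_lip l' by fastforce
  then obtain f where f: "\<forall>y\<in>x ` {..n}. f y = l' y" "\<forall>I. holder_bound 1 1 I f"
    using mcshane_extension[of "x ` {..n}" 1 1 l'] by auto
  have f_hol: "hol 1 f" using f(2) \<alpha>1 by simp
  have fx: "f (x i) = l i" if "i \<le> n" for i using f(1) l' that by auto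
  have "grid_sum n f = - (\<Sum>i<n. (g (x (Suc i)) - g a) * (f (x (Suc i)) - f (x i)))"
    unfolding x_def by (rule riemann_sum_by_parts[OF grid_partition[OF n]])
  also have "\<dots> = (\<Sum>i<n. \<bar>g (x (Suc i)) - g a\<bar> * ((b - a) / real n))"
    unfolding sum_negf[symmetric]
  proof (intro sum.cong refl)
    fix i assume "i \<in> {..<n}"
    then have "f (x (Suc i)) - f (x i) = s i * ((b - a) / real n)" using fx l_step by simp
    then show "- ((g (x (Suc i)) - g a) * (f (x (Suc i)) - f (x i))) = \<bar>g (x (Suc i)) - g a\<bar> * ((b - a) / real n)"
      by (simp add: s_def abs_sgn mult.assoc)
  qed
  finally show ?thesis
    using grid_sum_error[OF f_hol n] maximiser(3)[OF f_hol] unfolding x_def by linarith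
qed

text \<open>The dyadic intervals are the nodes of a binary heap: node 1 is \<open>[a,b]\<close> and the halves of
  node \<open>j\<close> are the nodes \<open>2 j\<close> and \<open>2 j + 1\<close>.\<close>

fun dyadic :: "nat \<Rightarrow> real \<times> real" where
  "dyadic j = (if j \<le> 1 then (a, b) else
     let (l, r) = dyadic (j div 2) in if even j then (l, (l + r) / 2) else ((l + r) / 2, r))"

declare dyadic.simps [simp del]

definition "left j = fst (dyadic j)"
definition "right j = snd (dyadic j)"

lemma dyadic_root: "j \<le> 1 \<Longrightarrow> left j = a" "j \<le> 1 \<Longrightarrow> right j = b"
  by (simp_all add: left_def right_def dyadic.simps)

lemma dyadic_children:
  assumes "1 \<le> j"
  shows "left (2 * j) = left j" "right (2 * j) = (left j + right j) / 2"
    "left (2 * j + 1) = (left j + right j) / 2" "right (2 * j + 1) = right j"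
  using assms dyadic.simps[of "2 * j"] dyadic.simps[of "2 * j + 1"]
  by (simp_all add: left_def right_def case_prod_unfold Let_def)

lemma dyadic_level:
  "i < 2 ^ n \<Longrightarrow> left (2 ^ n + i) = grid (2 ^ n) i \<and> right (2 ^ n + i) = grid (2 ^ n) (Suc i)"
proof (induction n arbitrary: i)
  case 0
  then show ?case by (simp add: dyadic_root grid_def)
next
  case (Suc n)
  define k where "k = i div 2"
  have k: "k < 2 ^ n" using Suc.prems by (simp add: k_def less_mult_imp_div_less)
  have ge: "1 \<le> 2 ^ n + k" by (simp add: Suc_le_eq)
  have even_grid: "grid (2 ^ Suc n) (2 * m) = grid (2 ^ n) m" for m by (simp add: grid_def)
  have mid: "(grid (2 ^ n) k + grid (2 ^ n) (Suc k)) / 2 = grid (2 ^ Suc n) (Suc (2 * k))"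
    by (simp add: grid_def field_simps)
  consider "i = 2 * k" | "i = 2 * k + 1" unfolding k_def by linarith
  then show ?case
  proof cases
    case 1
    then have "2 ^ Suc n + i = 2 * (2 ^ n + k)" by simp
    then show ?thesis
      using dyadic_children(1,2)[OF ge] Suc.IH[OF k] mid even_grid[of k] 1 by simp
  next
    case 2
    then have *: "2 ^ Suc n + i = 2 * (2 ^ n + k) + 1" by simp
    have "Suc i = 2 * Suc k" using 2 by simp
    then show ?thesis
      unfolding * using dyadic_children(3,4)[OF ge] Suc.IH[OF k] mid even_grid[of "Suc k"] 2 by simp
  qed
qed

lemma dyadic_nested:
  "a \<le> left j \<and> left j \<le> right j \<and> right j \<le> b \<and>
   (2 \<le> j \<longrightarrow> left (j div 2) \<le> left j \<and> right j \<le> right (j div 2))"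
proof (induction j rule: less_induct)
  case (less j)
  show ?case
  proof (cases "2 \<le> j")
    case False
    then show ?thesis using ab by (simp add: dyadic_root)
  next
    case True
    define k where "k = j div 2"
    have k: "k < j" "1 \<le> k" using True by (auto simp: k_def)
    consider "j = 2 * k" | "j = 2 * k + 1" unfolding k_def by linarith
    then show ?thesis
      using less.IH[OF k(1)] dyadic_children[OF k(2)] by cases (simp_all add: k_def[symmetric])
  qed
qed

text \<open>Passes from the nodes of one level to the uniform grid with \<open>2 ^ n\<close> cells,
  where the Riemann sum estimates hold.\<close>

lemma sum_level:
  "(\<Sum>j\<in>{2 ^ n..<2 ^ Suc n}. F (left j) (right j) j) =
   (\<Sum>i<2 ^ n. F (grid (2 ^ n) i) (grid (2 ^ n) (Suc i)) (2 ^ n + i))"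
  by (rule sum.reindex_bij_witness[of _ "\<lambda>i. 2 ^ n + i" "\<lambda>j. j - 2 ^ n"])
     (auto simp: dyadic_level dest!: le_Suc_ex)

text \<open>Infima, unlike samples or means, can only grow from an interval to its halves; positive
  and negative parts are separated so that this controls absolute values.\<close>

definition inf_above :: "nat \<Rightarrow> real" where
  "inf_above j = (INF x\<in>{left j..right j}. max 0 (g x - g a))"

definition inf_below :: "nat \<Rightarrow> real" where
  "inf_below j = (INF x\<in>{left j..right j}. max 0 (g a - g x))"

lemma inf_above_le: "x \<in> {left j..right j} \<Longrightarrow> inf_above j \<le> max 0 (g x - g a)"
  unfolding inf_above_def by (rule cINF_lower[OF bdd_belowI[of _ 0]]) auto

lemma inf_below_le: "x \<in> {left j..right j} \<Longrightarrow> inf_below j \<le> max 0 (g a - g x)"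
  unfolding inf_below_def by (rule cINF_lower[OF bdd_belowI[of _ 0]]) auto

lemma inf_above_ge: "(\<And>x. x \<in> {left j..right j} \<Longrightarrow> y \<le> max 0 (g x - g a)) \<Longrightarrow> y \<le> inf_above j"
  unfolding inf_above_def using dyadic_nested[of j] by (intro cINF_greatest) auto

lemma inf_below_ge: "(\<And>x. x \<in> {left j..right j} \<Longrightarrow> y \<le> max 0 (g a - g x)) \<Longrightarrow> y \<le> inf_below j"
  unfolding inf_below_def using dyadic_nested[of j] by (intro cINF_greatest) auto

lemma above_below_root: "inf_above 1 = 0" "inf_below 1 = 0"
proof -
  have "a \<in> {left 1..right 1}" using ab by (simp add: dyadic_root)
  then have "inf_above 1 \<le> 0" "inf_below 1 \<le> 0" using inf_above_le[of a 1] inf_below_le[of a 1] by auto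
  moreover have "0 \<le> inf_above 1" "0 \<le> inf_below 1" by (auto intro: inf_above_ge inf_below_ge)
  ultimately show "inf_above 1 = 0" "inf_below 1 = 0" by auto
qed

text \<open>At any point one of the two parts is zero, so one of the infima is zero over the child,
  and then also over the parent: a refinement changes at most one of them.\<close>

lemma above_below_parent:
  assumes "2 \<le> j"
  shows "inf_above (j div 2) \<le> inf_above j" "inf_below (j div 2) \<le> inf_below j"
    "inf_above j = inf_above (j div 2) \<or> inf_below j = inf_below (j div 2)"
proof -
  have sub: "{left j..right j} \<subseteq> {left (j div 2)..right (j div 2)}"
    using dyadic_nested[of j] assms by auto
  show up: "inf_above (j div 2) \<le> inf_above j" "inf_below (j div 2) \<le> inf_below j"
    using sub by (auto intro!: inf_above_ge inf_above_le inf_below_ge inf_below_le)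
  have nn: "0 \<le> inf_above k" "0 \<le> inf_below k" for k by (auto intro: inf_above_ge inf_below_ge)
  have l: "left j \<in> {left j..right j}" using dyadic_nested[of j] by simp
  have "inf_above j = 0 \<or> inf_below j = 0"
    using inf_above_le[OF l] inf_below_le[OF l] nn[of j] by (auto simp: max_def split: if_splits)
  then show "inf_above j = inf_above (j div 2) \<or> inf_below j = inf_below (j div 2)"
    using up nn[of "j div 2"] by auto
qed

text \<open>The first bound leads to \<open>grid_deviation_le\<close> and the cost, the second to
  the sum by parts and the value of \<open>J\<close>.\<close>

lemma above_below_sample:
  shows "inf_above j + inf_below j \<le> \<bar>g (right j) - g a\<bar>"
    and "\<bar>inf_above j - inf_below j - (g (right j) - g a)\<bar> \<le> (control (right j) - control (left j)) powr (1 / q)"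
proof -
  define w where "w = (control (right j) - control (left j)) powr (1 / q)"
  have nest: "a \<le> left j" "left j \<le> right j" "right j \<le> b" using dyadic_nested[of j] by auto
  have osc: "\<bar>g (right j) - g x\<bar> \<le> w" if "x \<in> {left j..right j}" for x
  proof -
    have "\<bar>g (right j) - g x\<bar> \<le> (control (right j) - control x) powr (1 / q)"
      using that nest by (intro increment_le_control) auto
    also have "\<dots> \<le> w"
      unfolding w_def using that nest q control_mono[of "left j" x] control_mono[of x "right j"]
      by (intro powr_mono2) auto
    finally show ?thesis .
  qed
  have r: "right j \<in> {left j..right j}" using nest by simp
  note upper = inf_above_le[OF r] inf_below_le[OF r]
  have lower: "max 0 (g (right j) - g a) - w \<le> inf_above j" "max 0 (g a - g (right j)) - w \<le> inf_below j"
    using osc by (auto intro!: inf_above_ge inf_below_ge; fastforce)+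
  show "inf_above j + inf_below j \<le> \<bar>g (right j) - g a\<bar>" using upper by linarith
  show "\<bar>inf_above j - inf_below j - (g (right j) - g a)\<bar> \<le> (control (right j) - control (left j)) powr (1 / q)"
    using upper lower unfolding w_def[symmetric] by linarith
qed

text \<open>The weight of a node. Node \<open>0\<close> is a dummy copy of the root and, like the
  root, gets none.\<close>

definition jump :: "nat \<Rightarrow> real" where
  "jump j = (if j < 2 then 0 else (inf_above j - inf_below j) - (inf_above (j div 2) - inf_below (j div 2)))"

text \<open>Only one infimum changes, and it grows. Hence absolute values of jumps telescope down
  the tree, which is what makes the coupling optimal.\<close>

lemma abs_jump: "2 \<le> j \<Longrightarrow> \<bar>jump j\<bar> = (inf_above j + inf_below j) - (inf_above (j div 2) + inf_below (j div 2))"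
  using above_below_parent[of j] by (auto simp: jump_def)

lemma sum_from_two:
  fixes F :: "nat \<Rightarrow> real"
  assumes "F 0 = 0" "F 1 = 0"
  shows "(\<Sum>j<2 ^ Suc n. F j) = (\<Sum>j\<in>{2..<2 ^ Suc n}. F j)"
proof (rule sum.mono_neutral_right)
  show "\<forall>j\<in>{..<2 ^ Suc n} - {2..<2 ^ Suc n}. F j = 0"
  proof
    fix j assume "j \<in> {..<2 ^ Suc n} - {2..<2 ^ Suc n :: nat}"
    then have "j = 0 \<or> j = 1" by auto
    then show "F j = 0" using assms by auto
  qed
qed auto

lemma dyadic_split:
  "1 \<le> j \<Longrightarrow> f (right j) - f (left j) =
     (f (right (2 * j)) - f (left (2 * j))) + (f (right (2 * j + 1)) - f (left (2 * j + 1)) :: real)"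
proof -
  assume j: "1 \<le> j"
  have "left (2 * j + 1) = right (2 * j)" using dyadic_children(2,3)[OF j] by simp
  then show ?thesis using dyadic_children(1,4)[OF j] by (simp del: Suc_eq_plus1 add_Suc_right)
qed

text \<open>Through level \<open>k\<close> the cost telescopes to the \<open>L\<^sup>1\<close> norm
  of the lower step function, at most \<open>dual_norm + grid_error (2 ^ k)\<close>. Partial sums
  increase, so for fixed \<open>n\<close> the level can go to infinity and the grid error
  disappears.\<close>

lemma jump_cost_le:
  assumes \<alpha>1: "\<alpha> = 1"
  shows "(\<Sum>j<n. \<bar>jump j\<bar> * (right j - left j)) \<le> dual_norm"
proof -
  define C where "C n = (\<Sum>j<n. \<bar>jump j\<bar> * (right j - left j))" for n
  have C_mono: "C n \<le> C m" if "n \<le> m" for n m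
    unfolding C_def using that dyadic_nested by (intro sum_mono2) auto
  have level: "C (2 ^ Suc k) \<le> dual_norm + grid_error (2 ^ k)" for k
  proof -
    have "C (2 ^ Suc k) = (\<Sum>j\<in>{2..<2 ^ Suc k}. \<bar>jump j\<bar> * (right j - left j))"
      unfolding C_def by (rule sum_from_two) (auto simp: jump_def)
    also have "\<dots> = (\<Sum>j\<in>{2..<2 ^ Suc k}. ((inf_above j + inf_below j) - (inf_above (j div 2) + inf_below (j div 2))) * (right j - left j))"
      by (intro sum.cong refl) (simp add: abs_jump)
    also have "\<dots> = (\<Sum>j\<in>{2 ^ k..<2 ^ Suc k}. (inf_above j + inf_below j) * (right j - left j))"
    proof (rule heap_telescope[of "\<lambda>j. inf_above j + inf_below j"])
      show "right j - left j = (right (2 * j) - left (2 * j)) + (right (2 * j + 1) - left (2 * j + 1))"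
        if "1 \<le> j" for j
        by (rule dyadic_split[OF that, of "\<lambda>x. x"])
    qed (use above_below_root in simp)
    also have "\<dots> \<le> (\<Sum>j\<in>{2 ^ k..<2 ^ Suc k}. \<bar>g (right j) - g a\<bar> * (right j - left j))"
      using dyadic_nested by (intro sum_mono mult_right_mono above_below_sample) auto
    also have "\<dots> = (\<Sum>i<2 ^ k. \<bar>g (grid (2 ^ k) (Suc i)) - g a\<bar> * ((b - a) / real (2 ^ k)))"
      unfolding sum_level[of "\<lambda>l r j. \<bar>g r - g a\<bar> * (r - l)"] grid_step by simp
    also have "\<dots> \<le> dual_norm + grid_error (2 ^ k)"
      by (rule grid_deviation_le[OF \<alpha>1]) simp
    finally show ?thesis .
  qed
  have "(\<lambda>k. dual_norm + grid_error (2 ^ k)) \<longlonglongrightarrow> dual_norm + 0"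
  proof (intro tendsto_intros)
    have "strict_mono (\<lambda>k. 2 ^ k :: nat)" by (intro strict_monoI) simp
    then show "(\<lambda>k. grid_error (2 ^ k)) \<longlonglongrightarrow> 0"
      using LIMSEQ_subseq_LIMSEQ[OF grid_error_tendsto] by (simp add: o_def)
  qed
  moreover have "C n \<le> dual_norm + grid_error (2 ^ k)" if "n \<le> k" for k
  proof -
    have "k < 2 ^ k" by (rule less_exp)
    then have "n \<le> 2 ^ Suc k" unfolding power_Suc using that by linarith
    then show ?thesis using C_mono level order_trans by blast
  qed
  ultimately have "C n \<le> dual_norm + 0"
    by (intro LIMSEQ_le_const) auto
  then show ?thesis by (simp add: C_def)
qed

lemma mean_oscillation_le:
  "(\<Sum>j\<in>{2 ^ n..<2 ^ Suc n}. (control (right j) - control (left j)) powr (1 / q)) / 2 ^ n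
    \<le> (1 + (control b - control a)) * (1 / 2 ^ n) powr (1 / q)"
proof -
  \<comment> \<open>This balances the terms of \<open>powr_le_affine\<close>: averaged over
    \<open>2 ^ n\<close> cells the constant gives \<open>d\<close>, the linear term \<open>d\<close>
    times the total control.\<close>
  define d where "d = (1 / 2 ^ n :: real) powr (1 / q)"
  have d: "0 < d" by (simp add: d_def)
  have "d powr (1 - q) * (1 / 2 ^ n) = d powr (1 - q) * d powr q"
    using q by (simp add: d_def powr_powr)
  also have "\<dots> = d" using d by (simp flip: powr_add)
  finally have d_eq: "d powr (1 - q) * (1 / 2 ^ n) = d" .
  have tele: "(\<Sum>j\<in>{2 ^ n..<2 ^ Suc n}. control (right j) - control (left j)) = control b - control a"
    unfolding sum_level[of "\<lambda>l r j. control r - control l"]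
    using sum_lessThan_telescope[of "\<lambda>i. control (grid (2 ^ n) i)" "2 ^ n"] by (simp add: grid_def)
  have "(\<Sum>j\<in>{2 ^ n..<2 ^ Suc n}. (control (right j) - control (left j)) powr (1 / q))
      \<le> (\<Sum>j\<in>{2 ^ n..<2 ^ Suc n}. d + d powr (1 - q) * (control (right j) - control (left j)))"
    using dyadic_nested control_mono by (intro sum_mono powr_le_affine d q) auto
  also have "\<dots> = 2 ^ n * d + d powr (1 - q) * (control b - control a)"
    by (simp only: sum.distrib sum_distrib_left[symmetric] tele) simp
  finally have "(\<Sum>j\<in>{2 ^ n..<2 ^ Suc n}. (control (right j) - control (left j)) powr (1 / q)) / 2 ^ n
      \<le> (2 ^ n * d + d powr (1 - q) * (control b - control a)) / 2 ^ n"
    by (intro divide_right_mono) auto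
  also have "\<dots> = d + (d powr (1 - q) * (1 / 2 ^ n)) * (control b - control a)"
    by (simp add: add_divide_distrib)
  also have "\<dots> = (1 + (control b - control a)) * d"
    unfolding d_eq by (simp add: algebra_simps)
  finally show ?thesis by (simp add: d_def)
qed

text \<open>Complete levels telescope to the sum by parts with \<open>g - g a\<close> replaced by
  its lower step function; the difference is at most \<open>A * (b - a)\<close> times the mean
  oscillation. The sign of \<open>- jump j\<close> is that of the summation by parts.\<close>

lemma jump_sum_tendsto:
  assumes \<alpha>1: "\<alpha> = 1" and f: "hol A f"
  shows "(\<lambda>n. \<Sum>j<2 ^ Suc n. - jump j * (f (right j) - f (left j))) \<longlonglongrightarrow> J f"
proof -
  have A: "0 \<le> A" using f by (simp add: holder_boundD)
  define S where "S n = (\<Sum>j<2 ^ Suc n. - jump j * (f (right j) - f (left j)))" for n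
  define D where "D j = f (right j) - f (left j)" for j
  have S_eq: "S n = - (\<Sum>j\<in>{2 ^ n..<2 ^ Suc n}. (inf_above j - inf_below j) * D j)" for n
  proof -
    have "S n = (\<Sum>j\<in>{2..<2 ^ Suc n}. - jump j * (f (right j) - f (left j)))"
      unfolding S_def by (rule sum_from_two) (auto simp: jump_def)
    also have "\<dots> = - (\<Sum>j\<in>{2..<2 ^ Suc n}. ((inf_above j - inf_below j) - (inf_above (j div 2) - inf_below (j div 2))) * D j)"
      unfolding sum_negf[symmetric] by (intro sum.cong refl) (simp add: jump_def D_def algebra_simps)
    also have "(\<Sum>j\<in>{2..<2 ^ Suc n}. ((inf_above j - inf_below j) - (inf_above (j div 2) - inf_below (j div 2))) * D j)
        = (\<Sum>j\<in>{2 ^ n..<2 ^ Suc n}. (inf_above j - inf_below j) * D j)"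
    proof (rule heap_telescope[of "\<lambda>j. inf_above j - inf_below j"])
      show "D j = D (2 * j) + D (2 * j + 1)" if "1 \<le> j" for j
        unfolding D_def by (rule dyadic_split[OF that])
    qed (use above_below_root in simp)
    finally show ?thesis .
  qed
  have close: "\<bar>S n - grid_sum (2 ^ n) f\<bar> \<le> A * (b - a) * ((1 + (control b - control a)) * (1 / 2 ^ n) powr (1 / q))" for n
  proof -
    have "grid_sum (2 ^ n) f = - (\<Sum>j\<in>{2 ^ n..<2 ^ Suc n}. (g (right j) - g a) * D j)"
      using riemann_sum_by_parts[OF grid_partition[of "2 ^ n"], of f]
      unfolding D_def sum_level[of "\<lambda>l r j. (g r - g a) * (f r - f l)"] by simp
    then have "\<bar>S n - grid_sum (2 ^ n) f\<bar> =
        \<bar>\<Sum>j\<in>{2 ^ n..<2 ^ Suc n}. (inf_above j - inf_below j - (g (right j) - g a)) * D j\<bar>"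
      unfolding S_eq by (simp add: left_diff_distrib sum_subtractf)
    also have "\<dots> \<le> (\<Sum>j\<in>{2 ^ n..<2 ^ Suc n}.
        (control (right j) - control (left j)) powr (1 / q) * (A * ((b - a) / 2 ^ n)))"
    proof (rule order_trans[OF sum_abs], rule sum_mono)
      fix j :: nat assume j: "j \<in> {2 ^ n..<2 ^ Suc n}"
      define i where "i = j - 2 ^ n"
      have i: "j = 2 ^ n + i" "i < 2 ^ n" using j by (auto simp: i_def)
      have "right j - left j = (b - a) / 2 ^ n"
        using dyadic_level[OF i(2)] grid_step[of "2 ^ n" i] i(1) by simp
      moreover have "\<bar>D j\<bar> \<le> A * \<bar>right j - left j\<bar> powr \<alpha>"
        unfolding D_def using dyadic_nested[of j] by (intro holder_boundD(1)[OF f]) auto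
      ultimately have "\<bar>D j\<bar> \<le> A * ((b - a) / 2 ^ n)" using \<alpha>1 ab by simp
      then show "\<bar>(inf_above j - inf_below j - (g (right j) - g a)) * D j\<bar>
          \<le> (control (right j) - control (left j)) powr (1 / q) * (A * ((b - a) / 2 ^ n))"
        unfolding abs_mult by (intro mult_mono above_below_sample) auto
    qed
    also have "\<dots> = A * (b - a) *
        ((\<Sum>j\<in>{2 ^ n..<2 ^ Suc n}. (control (right j) - control (left j)) powr (1 / q)) / 2 ^ n)"
      unfolding sum_distrib_right[symmetric] by simp
    also have "\<dots> \<le> A * (b - a) * ((1 + (control b - control a)) * (1 / 2 ^ n) powr (1 / q))"
      using A ab by (intro mult_left_mono mean_oscillation_le) auto
    finally show ?thesis .
  qed
  have "(\<lambda>n. (1 / 2) ^ n :: real) \<longlonglongrightarrow> 0" by (rule LIMSEQ_power_zero) simp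
  then have "(\<lambda>n. 1 / 2 ^ n :: real) \<longlonglongrightarrow> 0" by (simp add: power_divide)
  moreover have "\<forall>\<^sub>F n in sequentially. (0 :: real) \<le> 1 / 2 ^ n" by simp
  ultimately have "(\<lambda>n. (1 / 2 ^ n :: real) powr (1 / q)) \<longlonglongrightarrow> 0 powr (1 / q)"
    using tendsto_powr'[OF _ tendsto_const, of "\<lambda>n. 1 / 2 ^ n" 0 sequentially "1 / q"] q by auto
  then have "(\<lambda>n. A * (b - a) * ((1 + (control b - control a)) * (1 / 2 ^ n) powr (1 / q)))
      \<longlonglongrightarrow> A * (b - a) * ((1 + (control b - control a)) * 0 powr (1 / q))"
    by (intro tendsto_mult_left)
  then have bound: "(\<lambda>n. A * (b - a) * ((1 + (control b - control a)) * (1 / 2 ^ n) powr (1 / q))) \<longlonglongrightarrow> 0"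
    by simp
  have "(\<lambda>n. S n - grid_sum (2 ^ n) f) \<longlonglongrightarrow> 0"
    by (rule Lim_null_comparison[OF _ bound]) (use close in \<open>auto intro!: always_eventually\<close>)
  moreover have "(\<lambda>n. grid_sum (2 ^ n) f) \<longlonglongrightarrow> J f"
  proof -
    have "strict_mono (\<lambda>k. 2 ^ k :: nat)" by (intro strict_monoI) simp
    then show ?thesis
      using LIMSEQ_subseq_LIMSEQ[OF grid_sum_tendsto[OF f]] by (simp add: o_def)
  qed
  ultimately have "(\<lambda>n. (S n - grid_sum (2 ^ n) f) + grid_sum (2 ^ n) f) \<longlonglongrightarrow> 0 + J f"
    by (rule tendsto_add)
  then show ?thesis by (simp add: S_def)
qed

text \<open>Node \<open>j\<close> carries an atom of mass \<open>\<bar>jump j\<bar>\<close> at its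
  pair of end points. The masses need not be summable, only mass times length; as the image of a
  density on \<open>nat\<close>, the measure has series as integrals.\<close>

lemma coupling_exists_lipschitz:
  assumes \<alpha>1: "\<alpha> = 1"
  shows "\<exists>\<pi>\<in>couplings \<alpha> a b g. transport_cost \<alpha> \<pi> \<le> ennreal dual_norm"
proof -
  define R where "R = (restrict_space borel ({a..b} \<times> {a..b}) :: (real \<times> real) measure)"
  \<comment> \<open>A positive jump has to contribute \<open>f (left j) - f (right j)\<close>, so
    its atom runs from right to left.\<close>
  define z where "z j = (if 0 < jump j then (right j, left j) else (left j, right j))" for j
  define N where "N = density (count_space UNIV) (\<lambda>j. ennreal \<bar>jump j\<bar>)"
  define \<pi> where "\<pi> = distr N R z"
  have z_in: "z j \<in> {a..b} \<times> {a..b}" for j using dyadic_nested[of j] by (auto simp: z_def)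
  have z_meas: "z \<in> measurable N R"
    using z_in by (simp add: measurable_def N_def R_def space_restrict_space)
  have diff: "\<bar>jump j\<bar> * (f (snd (z j)) - f (fst (z j))) = - jump j * (f (right j) - f (left j))" for f :: "real \<Rightarrow> real" and j
    by (auto simp: z_def abs_if algebra_simps)
  have dist: "\<bar>snd (z j) - fst (z j)\<bar> = right j - left j" for j
    using dyadic_nested[of j] by (auto simp: z_def)
  note R_meas = difference_quotient_measurable[OF _ refl, folded R_def]
  have "transport_cost \<alpha> \<pi> = (\<integral>\<^sup>+j. ennreal (\<bar>snd (z j) - fst (z j)\<bar> powr \<alpha>) \<partial>N)"
    unfolding transport_cost_def \<pi>_def case_prod_unfold
    by (rule nn_integral_distr[OF z_meas]) (use R_meas(3)[OF hol_const] in measurable)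
  also have "\<dots> = (\<integral>\<^sup>+j. ennreal \<bar>jump j\<bar> * ennreal (right j - left j) \<partial>count_space UNIV)"
    unfolding N_def using dyadic_nested by (subst nn_integral_density) (auto simp: dist \<alpha>1)
  also have "\<dots> = (\<Sum>j. ennreal (\<bar>jump j\<bar> * (right j - left j)))"
    using dyadic_nested by (simp add: nn_integral_count_space_nat ennreal_mult)
  also have "\<dots> \<le> ennreal dual_norm"
  proof (rule suminf_le_const[OF summableI])
    fix n
    have "(\<Sum>j<n. ennreal (\<bar>jump j\<bar> * (right j - left j))) = ennreal (\<Sum>j<n. \<bar>jump j\<bar> * (right j - left j))"
      using dyadic_nested by (intro sum_ennreal) auto
    also have "\<dots> \<le> ennreal dual_norm" by (intro ennreal_leI jump_cost_le \<alpha>1)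
    finally show "(\<Sum>j<n. ennreal (\<bar>jump j\<bar> * (right j - left j))) \<le> ennreal dual_norm" .
  qed
  finally have cost: "transport_cost \<alpha> \<pi> \<le> ennreal dual_norm" .
  have "(\<integral>(s, t). f t - f s \<partial>\<pi>) = J f" if f_in: "f \<in> holder_space \<alpha> {a..b}" for f
  proof -
    obtain A where f: "hol A f" using holder_space_bound[OF f_in] by blast
    have A: "0 \<le> A" using f by (simp add: holder_boundD)
    define F where "F j = - jump j * (f (right j) - f (left j))" for j
    have "(\<integral>(s, t). f t - f s \<partial>\<pi>) = (\<integral>j. f (snd (z j)) - f (fst (z j)) \<partial>N)"
      unfolding \<pi>_def case_prod_unfold by (rule integral_distr[OF z_meas R_meas(2)[OF f]])
    also have "\<dots> = (\<integral>j. \<bar>jump j\<bar> *\<^sub>R (f (snd (z j)) - f (fst (z j))) \<partial>count_space UNIV)"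
      unfolding N_def by (rule integral_density) auto
    also have "\<dots> = (\<integral>j. F j \<partial>count_space UNIV)" by (simp add: F_def diff)
    finally have int: "(\<integral>(s, t). f t - f s \<partial>\<pi>) = (\<integral>j. F j \<partial>count_space UNIV)" .
    have F_le: "norm (F j) \<le> A * (\<bar>jump j\<bar> * (right j - left j))" for j
    proof -
      have "\<bar>f (right j) - f (left j)\<bar> \<le> A * \<bar>right j - left j\<bar> powr \<alpha>"
        using dyadic_nested[of j] by (intro holder_boundD(1)[OF f]) auto
      then have "\<bar>jump j\<bar> * \<bar>f (right j) - f (left j)\<bar> \<le> \<bar>jump j\<bar> * (A * (right j - left j))"
        using dyadic_nested[of j] \<alpha>1 by (intro mult_left_mono) auto
      moreover have "norm (F j) = \<bar>jump j\<bar> * \<bar>f (right j) - f (left j)\<bar>"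
        unfolding F_def real_norm_def abs_mult by simp
      ultimately show ?thesis by (simp add: mult.left_commute)
    qed
    have "summable (\<lambda>j. \<bar>jump j\<bar> * (right j - left j))"
      using dyadic_nested by (intro bounded_imp_summable[OF _ jump_cost_le[OF \<alpha>1, of "Suc _", unfolded lessThan_Suc_atMost]]) auto
    then have "summable (\<lambda>j. A * (\<bar>jump j\<bar> * (right j - left j)))" by (rule summable_mult)
    then have summ: "summable (\<lambda>j. norm (F j))"
      by (rule summable_comparison_test'[where N=0]) (use F_le in auto)
    then have "F sums (\<integral>j. F j \<partial>count_space UNIV)"
      by (intro sums_integral_count_space_nat) (simp add: integrable_count_space_nat_iff)
    then have "(\<lambda>n. \<Sum>j<n. F j) \<longlonglongrightarrow> (\<integral>j. F j \<partial>count_space UNIV)" by (simp add: sums_def)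
    \<comment> \<open>The whole series converges, so its sum can be read off along complete levels,
      where \<open>jump_sum_tendsto\<close> applies.\<close>
    moreover have "strict_mono (\<lambda>n. 2 ^ Suc n :: nat)" by (intro strict_monoI) simp
    ultimately have "(\<lambda>n. \<Sum>j<2 ^ Suc n. F j) \<longlonglongrightarrow> (\<integral>j. F j \<partial>count_space UNIV)"
      using LIMSEQ_subseq_LIMSEQ[of "\<lambda>n. \<Sum>j<n. F j" _ "\<lambda>n. 2 ^ Suc n"] by (simp add: o_def)
    then have "(\<integral>j. F j \<partial>count_space UNIV) = J f"
      by (rule LIMSEQ_unique) (unfold F_def, rule jump_sum_tendsto[OF \<alpha>1 f])
    then show ?thesis using int by simp
  qed
  moreover have "sets \<pi> = sets (restrict_space borel ({a..b} \<times> {a..b}))" by (simp add: \<pi>_def R_def)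
  ultimately have "\<pi> \<in> couplings \<alpha> a b g"
    using le_less_trans[OF cost ennreal_less_top] by (simp add: couplings_def)
  then show ?thesis using cost by blast
qed

section \<open>Weak duality and attainment\<close>

lemma dual_norm_le_cost:
  assumes "\<pi> \<in> couplings \<alpha> a b g"
  shows "ennreal dual_norm \<le> transport_cost \<alpha> \<pi>"
proof -
  have sets: "sets \<pi> = sets (restrict_space borel ({a..b} \<times> {a..b}))"
    using assms by (simp add: couplings_def)
  have space: "space \<pi> = {a..b} \<times> {a..b}"
    using sets_eq_imp_space_eq[OF sets] by (simp add: space_restrict_space)
  define h where "h z = maximiser (snd z) - maximiser (fst z)" for z
  have "maximiser \<in> holder_space \<alpha> {a..b}"
    using le_less_trans[OF holder_seminorm_le[OF maximiser(1)] ennreal_less_top]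
    by (simp add: holder_space_def)
  then have "(\<integral>(s, t). maximiser t - maximiser s \<partial>\<pi>) = dual_norm"
    using assms unfolding couplings_def by blast
  then have J_eq: "dual_norm = integral\<^sup>L \<pi> h"
    by (simp add: h_def[abs_def] case_prod_unfold)
  show ?thesis
  proof (cases "integrable \<pi> h")
    case True
    have "ennreal dual_norm \<le> ennreal (norm (integral\<^sup>L \<pi> h))"
      by (intro ennreal_leI) (simp add: J_eq)
    also have "\<dots> \<le> (\<integral>\<^sup>+z. ennreal (norm (h z)) \<partial>\<pi>)"
      by (rule integral_norm_bound_ennreal[OF True])
    also have "\<dots> \<le> transport_cost \<alpha> \<pi>"
      unfolding transport_cost_def case_prod_unfold
    proof (intro nn_integral_mono ennreal_leI)
      fix z assume "z \<in> space \<pi>"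
      then show "norm (h z) \<le> \<bar>snd z - fst z\<bar> powr \<alpha>"
        using holder_boundD(1)[OF maximiser(1), of "fst z" "snd z"] by (simp add: space mem_Times_iff h_def)
    qed
    finally show ?thesis .
  next
    \<comment> \<open>The integral of a non-integrable function is zero by convention, so
      \<open>dual_norm\<close> is zero here.\<close>
    case False
    then show ?thesis using J_eq by (simp add: not_integrable_integral_eq)
  qed
qed

text \<open>As \<open>maximiser c = 0\<close>, the maximiser of the seminorm ball already lies in
  the smaller ball of the full norm.\<close>

lemma W_norm_eq: "W_norm \<alpha> a b c g = ereal dual_norm"
proof (rule antisym)
  show "W_norm \<alpha> a b c g \<le> ereal dual_norm"
    unfolding W_norm_def
  proof (rule SUP_least, clarify)
    fix f assume "holder_norm \<alpha> {a..b} c f \<le> 1"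
    then have "holder_seminorm \<alpha> {a..b} f \<le> 1"
      unfolding holder_norm_def by (metis add.commute add_increasing2 order_trans order_refl zero_le)
    then have "hol 1 f" by (intro holder_seminorm_bound) auto
    then show "ereal (J f) \<le> ereal dual_norm" using maximiser(3) by simp
  qed
  show "ereal dual_norm \<le> W_norm \<alpha> a b c g"
    unfolding W_norm_def
    by (rule SUP_upper) (use holder_seminorm_le[OF maximiser(1)] maximiser(2) in \<open>simp add: holder_norm_def\<close>)
qed

text \<open>If \<open>dual_norm\<close> is positive, homogeneity rules out a maximiser of seminorm
  below one. If it is zero, \<open>J\<close> vanishes on the ball by the symmetry
  \<open>f \<mapsto> - f\<close>, and \<open>\<bar>x - c\<bar> powr \<alpha>\<close>, whose
  quotients at \<open>c\<close> equal one, serves.\<close>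

lemma extremal_exists:
  "\<exists>f. holder_seminorm \<alpha> {a..b} f = 1 \<and> f c = 0 \<and> J f = dual_norm"
proof (cases "dual_norm = 0")
  case False
  then have pos: "0 < dual_norm" using dual_norm_nonneg by simp
  define A where "A = enn2real (holder_seminorm \<alpha> {a..b} maximiser)"
  have le1: "holder_seminorm \<alpha> {a..b} maximiser \<le> 1"
    using holder_seminorm_le[OF maximiser(1)] by simp
  then have A: "holder_seminorm \<alpha> {a..b} maximiser = ennreal A"
    using le_less_trans[OF le1 ennreal_one_less_top] by (simp add: A_def)
  have "hol A maximiser" by (rule holder_seminorm_bound) (use A in \<open>auto simp: A_def\<close>)
  then have "dual_norm \<le> A * dual_norm" by (rule young_le_dual_norm)
  then have "1 \<le> A" using pos by simp
  then have "holder_seminorm \<alpha> {a..b} maximiser = 1"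
    using le1 unfolding A by (metis antisym ennreal_1 ennreal_leI)
  then show ?thesis using maximiser(2) by blast
next
  case True
  define f where "f x = \<bar>x - c\<bar> powr \<alpha>" for x
  have f: "hol 1 f"
    unfolding holder_bound_def
  proof (intro conjI ballI)
    fix s t
    have "\<bar>t - c\<bar> powr \<alpha> \<le> \<bar>t - s\<bar> powr \<alpha> + \<bar>s - c\<bar> powr \<alpha>"
      "\<bar>s - c\<bar> powr \<alpha> \<le> \<bar>s - t\<bar> powr \<alpha> + \<bar>t - c\<bar> powr \<alpha>"
      by (intro powr_dist_triangle \<alpha>_pos \<alpha>(2))+
    then show "\<bar>f t - f s\<bar> \<le> 1 * \<bar>t - s\<bar> powr \<alpha>"
      unfolding f_def abs_minus_commute[of s t] by linarith
  qed simp
  define t where "t = (if c = a then b else a)"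
  have t: "t \<in> {a..b}" "t \<noteq> c" using ab by (auto simp: t_def)
  have "ennreal (\<bar>f t - f c\<bar> / \<bar>t - c\<bar> powr \<alpha>) \<le> holder_seminorm \<alpha> {a..b} f"
    unfolding holder_seminorm_def by (rule SUP_upper2[of "(c, t)"]) (use c t in auto)
  moreover have "\<bar>f t - f c\<bar> / \<bar>t - c\<bar> powr \<alpha> = 1" using t(2) by (simp add: f_def)
  ultimately have "holder_seminorm \<alpha> {a..b} f = 1"
    using holder_seminorm_le[OF f] by (simp add: antisym)
  moreover have "J f \<le> 0" "- J f \<le> 0"
    using maximiser(3)[OF f] maximiser(3)[of "\<lambda>x. -1 * f x"] hol_scale[OF f, of "-1"]
      young_scale[OF f, of "-1"] True by auto
  ultimately show ?thesis using True by (intro exI[of _ f]) (simp add: f_def)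
qed

lemma optimal_coupling_exists:
  "\<exists>\<pi>\<in>couplings \<alpha> a b g. transport_cost \<alpha> \<pi> = ennreal dual_norm"
  using coupling_exists_subunit coupling_exists_lipschitz dual_norm_le_cost \<alpha>(2)
  by (metis antisym less_eq_real_def)

end

theorem proposition4p1:
  fixes a b c q \<alpha> :: real and g :: "real \<Rightarrow> real"
  assumes "a < b"
    and "c \<in> {a..b}"
    and "q > 1"
    and "\<forall>t \<in> {a..<b}. continuous (at_right t) g"
    and "q_variation q {a..b} g < \<infinity>"
    and "g a = g b"
    and "1 - 1 / q < \<alpha>" and "\<alpha> \<le> 1"
  shows "(\<exists>f. holder_seminorm \<alpha> {a..b} f = 1 \<and> holder_norm \<alpha> {a..b} c f \<le> 1 \<and>
              ereal (young_integral a b f g) = W_norm \<alpha> a b c g) \<and>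
         (\<exists>\<pi> \<in> couplings \<alpha> a b g.
              (\<forall>\<pi>' \<in> couplings \<alpha> a b g. transport_cost \<alpha> \<pi> \<le> transport_cost \<alpha> \<pi>') \<and>
              W_norm \<alpha> a b c g = enn2ereal (transport_cost \<alpha> \<pi>)) \<and>
         W_norm \<alpha> a b c g < \<infinity>"
proof -
  interpret young_loop a b q \<alpha> g c
    using assms by unfold_locales auto
  obtain f where f: "holder_seminorm \<alpha> {a..b} f = 1" "f c = 0" "J f = dual_norm"
    using extremal_exists by blast
  have "holder_norm \<alpha> {a..b} c f \<le> 1" using f by (simp add: holder_norm_def)
  then have primal: "\<exists>f. holder_seminorm \<alpha> {a..b} f = 1 \<and> holder_norm \<alpha> {a..b} c f \<le> 1 \<and>
      ereal (J f) = W_norm \<alpha> a b c g"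
    using f by (auto simp: W_norm_eq)
  obtain \<pi> where \<pi>: "\<pi> \<in> couplings \<alpha> a b g" "transport_cost \<alpha> \<pi> = ennreal dual_norm"
    using optimal_coupling_exists by blast
  have "W_norm \<alpha> a b c g = enn2ereal (transport_cost \<alpha> \<pi>)"
    using dual_norm_nonneg by (simp add: \<pi>(2) W_norm_eq)
  moreover have "\<forall>\<pi>'\<in>couplings \<alpha> a b g. transport_cost \<alpha> \<pi> \<le> transport_cost \<alpha> \<pi>'"
    using dual_norm_le_cost by (simp add: \<pi>(2))
  ultimately show ?thesis
    using primal \<pi>(1) by (auto simp: W_norm_eq)
qed

end
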